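(* Every co-bridge-free orientable prismatic graph that is not 3-colorable admits a hitting set of the triangles of size at most $5$.
   Context: A triangle is a set of three pairwise adjacent vertices. A graph $G$ is prismatic if for every triangle $T$ of $G$, every vertex not in $T$ has exactly one neighbor in $T$. The co-bridge is $C_4+2K_1$; co-bridge-free means no induced subgraph isomorphic to it. An orientation of $G$ is a choice of a cyclic permutation $\mathcal O(T)$ of each triangle $T$ such that whenever $S=\{s_1,s_2,s_3\}$ and $T=\{t_1,t_2,t_3\}$ are disjoint triangles with $s_it_i$ an edge for $1\le i\le 3$, $\mathcal O(S)$ is $s_1\to s_2\to s_3\to s_1$ if and only if $\mathcal O(T)$ is $t_1\to t_2\to t_3\to t_1$; $G$ is orientable if it admits an orientation. 3-colorable means $V(G)$ can be partitioned into three stable sets. A hitting set is a set of vertices meeting every triangle. *)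

theory Defs
  imports
    "Graph_Theory.Pair_Digraph"
    "Graph_Theory.Digraph_Isomorphism"
    "HOL-Combinatorics.Cycles"
begin

text \<open>Finite simple graphs are rendered by the locale \<^locale>\<open>pair_graph\<close>: a finite, symmetric and
  loop-free set of arcs, an edge \<open>uv\<close> being the pair of arcs \<open>(u, v)\<close> and \<open>(v, u)\<close>.\<close>

definition triangle :: "'a pair_pre_digraph \<Rightarrow> 'a set \<Rightarrow> bool" where
  "triangle G T \<longleftrightarrow> T \<subseteq> pverts G \<and> card T = 3 \<and>
     (\<forall>u\<in>T. \<forall>v\<in>T. u \<noteq> v \<longrightarrow> (u, v) \<in> parcs G)"

definition prismatic :: "'a pair_pre_digraph \<Rightarrow> bool" where
  "prismatic G \<longleftrightarrow>
     (\<forall>T. triangle G T \<longrightarrow> (\<forall>v \<in> pverts G - T. \<exists>!u. u \<in> T \<and> (v, u) \<in> parcs G))"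

text \<open>\<open>C\<^sub>4 + 2K\<^sub>1\<close>: the 4-cycle \<open>0123\<close> together with the isolated vertices \<open>4\<close> and \<open>5\<close>.\<close>

definition co_bridge :: "nat pair_pre_digraph" where
  "co_bridge = (let R = {(0, 1), (1, 2), (2, 3), (3, 0)} in
     \<lparr> pverts = {0, 1, 2, 3, 4, 5}, parcs = R \<union> R\<inverse> \<rparr>)"

lemma pair_graph_co_bridge: "pair_graph co_bridge"
  by unfold_locales
    (auto simp: co_bridge_def Let_def symmetric_def intro!: symI)

definition co_bridge_free :: "'a pair_pre_digraph \<Rightarrow> bool" where
  "co_bridge_free G \<longleftrightarrow>
     \<not> (\<exists>H. induced_subgraph (with_proj H) (with_proj G) \<and>
            digraph_iso (with_proj co_bridge) (with_proj H))"

text \<open>An orientation assigns to each triangle \<open>T\<close> a cyclic permutation \<open>Or T\<close> of \<open>T\<close>, extended by the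
  identity outside \<open>T\<close>; \<open>cycle_of_list [a, b, c]\<close> is the permutation \<open>a \<rightarrow> b \<rightarrow> c \<rightarrow> a\<close>. The values of
  \<open>Or\<close> on sets that are not triangles are irrelevant.\<close>

definition orientation :: "'a pair_pre_digraph \<Rightarrow> ('a set \<Rightarrow> 'a \<Rightarrow> 'a) \<Rightarrow> bool" where
  "orientation G Or \<longleftrightarrow>
     (\<forall>T. triangle G T \<longrightarrow> (\<exists>a b c. T = {a, b, c} \<and> Or T = cycle_of_list [a, b, c])) \<and>
     (\<forall>s1 s2 s3 t1 t2 t3.
        triangle G {s1, s2, s3} \<and> triangle G {t1, t2, t3} \<and>
        {s1, s2, s3} \<inter> {t1, t2, t3} = {} \<and>
        (s1, t1) \<in> parcs G \<and> (s2, t2) \<in> parcs G \<and> (s3, t3) \<in> parcs G \<longrightarrow>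
        (Or {s1, s2, s3} = cycle_of_list [s1, s2, s3] \<longleftrightarrow>
         Or {t1, t2, t3} = cycle_of_list [t1, t2, t3]))"

definition orientable :: "'a pair_pre_digraph \<Rightarrow> bool" where
  "orientable G \<longleftrightarrow> (\<exists>Or. orientation G Or)"

definition stable_set :: "'a pair_pre_digraph \<Rightarrow> 'a set \<Rightarrow> bool" where
  "stable_set G A \<longleftrightarrow> A \<subseteq> pverts G \<and> (\<forall>u\<in>A. \<forall>v\<in>A. (u, v) \<notin> parcs G)"

text \<open>As usual for colorings, the color classes may be empty.\<close>

definition three_colorable :: "'a pair_pre_digraph \<Rightarrow> bool" where
  "three_colorable G \<longleftrightarrow>
     (\<exists>A B C. stable_set G A \<and> stable_set G B \<and> stable_set G C \<and>
        A \<inter> B = {} \<and> A \<inter> C = {} \<and> B \<inter> C = {} \<and> A \<union> B \<union> C = pverts G)"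

definition hitting_set :: "'a pair_pre_digraph \<Rightarrow> 'a set \<Rightarrow> bool" where
  "hitting_set G X \<longleftrightarrow> X \<subseteq> pverts G \<and> (\<forall>T. triangle G T \<longrightarrow> X \<inter> T \<noteq> {})"

end

theory Submission
  imports Defs
begin

text \<open>Write \<open>D a b c\<close> for a triangle oriented \<open>a \<rightarrow> b \<rightarrow> c\<close>, fix a vertex \<open>b\<close> in at least two triangles, and let
  \<open>X\<close> and \<open>Y\<close> be the sets of successors and predecessors of \<open>b\<close>, so that the triangles at \<open>b\<close> are
  \<open>b \<rightarrow> x \<rightarrow> y\<close>. Every triangle avoiding \<open>b\<close> has exactly one neighbour \<open>v\<close> of \<open>b\<close>; if it is
  \<open>v \<rightarrow> p \<rightarrow> q\<close>, then comparing it with the triangles at \<open>b\<close> shows that \<open>p\<close> is essentially complete to \<open>X\<close>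
  and \<open>q\<close> to \<open>Y\<close>. If no such triangle has its vertex \<open>v\<close> in \<open>X\<close> (or none in \<open>Y\<close>), this splitting is
  turned into a 3-coloring unless two vertices besides \<open>b\<close> hit all triangles.

  So let \<open>x \<rightarrow> p \<rightarrow> q\<close> and \<open>y \<rightarrow> p' \<rightarrow> q'\<close> be triangles on both sides. If \<open>x\<close> and \<open>y\<close> are in different
  triangles at \<open>b\<close> and \<open>q \<noteq> p'\<close>, then co-bridge-freeness forces all triangles \<open>v \<rightarrow> p\<^sub>1 \<rightarrow> q\<^sub>1\<close> with
  \<open>v \<notin> X \<union> Y\<close>, \<open>p\<^sub>1 \<noteq> p\<close>, \<open>q\<^sub>1 \<noteq> q'\<close> through a single vertex, which leads to a hitting set of size 5. This
  settles the case that \<open>b\<close> is in three triangles. When all vertices are in at most two triangles, the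
  remaining configurations are \<open>L(K\<^sub>3\<^sub>,\<^sub>3)\<close> and \<open>L(K\<^sub>3\<^sub>,\<^sub>3)\<close> minus a vertex: the rest of the graph attaches to
  them along the rows of the grid, which yields a 3-coloring. Finally, if every vertex is in at most one
  triangle, the neighbourhoods of the vertices of one triangle give a 3-coloring.\<close>

section \<open>Hitting sets, colorings and triangles for a bare adjacency relation and a relation of
  oriented triangles\<close>

definition hit5 :: "('a \<Rightarrow> 'a \<Rightarrow> 'a \<Rightarrow> bool) \<Rightarrow> bool" where
  "hit5 D \<longleftrightarrow> (\<exists>S. finite S \<and> card S \<le> 5 \<and> (\<forall>a b c. D a b c \<longrightarrow> S \<inter> {a, b, c} \<noteq> {}))"

lemma hit5_reverse: "hit5 (\<lambda>a b c. D a c b) = hit5 D"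
  unfolding hit5_def by (metis insert_commute)

text \<open>The classes may overlap and may leave \<open>V\<close>, so any three stable sets
  covering \<open>V\<close> serve as a coloring; \<open>colorable3_three_colorable\<close> trims
  them to a partition.\<close>

definition colorable3 :: "'a set \<Rightarrow> ('a \<Rightarrow> 'a \<Rightarrow> bool) \<Rightarrow> bool" where
  "colorable3 V E \<longleftrightarrow> (\<exists>A B C. V \<subseteq> A \<union> B \<union> C \<and> (\<forall>u\<in>A. \<forall>v\<in>A. \<not> E u v) \<and>
     (\<forall>u\<in>B. \<forall>v\<in>B. \<not> E u v) \<and> (\<forall>u\<in>C. \<forall>v\<in>C. \<not> E u v))"

lemma colorable3I:
  assumes "V \<subseteq> A \<union> B \<union> C" "\<And>u v. u \<in> A \<Longrightarrow> v \<in> A \<Longrightarrow> \<not> E u v"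
    "\<And>u v. u \<in> B \<Longrightarrow> v \<in> B \<Longrightarrow> \<not> E u v" "\<And>u v. u \<in> C \<Longrightarrow> v \<in> C \<Longrightarrow> \<not> E u v"
  shows "colorable3 V E"
  unfolding colorable3_def using assms by (intro exI[of _ A] exI[of _ B] exI[of _ C]) simp

text \<open>In the locale below \<open>D\<close> is closed under rotation, so a triangle avoiding
  \<open>b\<close> can be listed with its only neighbour of \<open>b\<close> first. \<open>D\<close>
  is an explicit argument so that the notion also applies to the reversed orientation.\<close>

definition outer :: "('a \<Rightarrow> 'a \<Rightarrow> bool) \<Rightarrow> ('a \<Rightarrow> 'a \<Rightarrow> 'a \<Rightarrow> bool) \<Rightarrow> 'a \<Rightarrow> 'a \<Rightarrow> 'a \<Rightarrow> 'a \<Rightarrow> bool" where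
  "outer E D b v p q \<longleftrightarrow> D v p q \<and> E b v \<and> b \<noteq> p \<and> b \<noteq> q"

lemma outer_reverse: "outer E D b v p q \<Longrightarrow> outer E (\<lambda>a b c. D a c b) b v q p"
  by (auto simp: outer_def)

text \<open>Comparing the successors of \<open>v\<close> suffices to count its triangles, since an
  edge lies in only one triangle (\<open>common_nbr\<close>).\<close>

definition at_most_two :: "('a \<Rightarrow> 'a \<Rightarrow> 'a \<Rightarrow> bool) \<Rightarrow> bool" where
  "at_most_two D \<longleftrightarrow> (\<forall>v x y x' y' x'' y''. D v x y \<longrightarrow> D v x' y' \<longrightarrow> D v x'' y'' \<longrightarrow>
     x = x' \<or> x = x'' \<or> x' = x'')"

lemma at_most_twoD: "at_most_two D \<Longrightarrow> D v x y \<Longrightarrow> D v x' y' \<Longrightarrow> D v x'' y'' \<Longrightarrow> x = x' \<or> x = x'' \<or> x' = x''"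
  unfolding at_most_two_def by blast

section \<open>Oriented prismatic graphs\<close>

text \<open>\<open>D\<close> selects one of the two cyclic orders of each triangle. By
  \<open>match\<close>, an edge between disjoint triangles carries the next pair of vertices along,
  so the matching between the two triangles respects their cyclic orders. All assumptions survive
  reversing the orientation, which halves the case analysis.\<close>

locale oriented_prismatic =
  fixes V :: "'a set" and E :: "'a \<Rightarrow> 'a \<Rightarrow> bool" and D :: "'a \<Rightarrow> 'a \<Rightarrow> 'a \<Rightarrow> bool"
  assumes E_sym: "E u v \<Longrightarrow> E v u"
    and E_irrefl: "\<not> E u u"
    and E_V: "E u v \<Longrightarrow> u \<in> V"
    and tri: "E a b \<Longrightarrow> E b c \<Longrightarrow> E a c \<Longrightarrow> D a b c \<or> D a c b"
    and D_edge: "D a b c \<Longrightarrow> E a b"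
    and D_rot: "D a b c \<Longrightarrow> D b c a"
    and D_asym: "D a b c \<Longrightarrow> \<not> D a c b"
    and prism_ex: "D a b c \<Longrightarrow> v \<in> V \<Longrightarrow> v \<notin> {a, b, c} \<Longrightarrow> E v a \<or> E v b \<or> E v c"
    and prism_uniq: "D a b c \<Longrightarrow> E v a \<Longrightarrow> E v b \<Longrightarrow> v = c"
    and match: "D a b c \<Longrightarrow> D a' b' c' \<Longrightarrow> {a, b, c} \<inter> {a', b', c'} = {} \<Longrightarrow> E a a' \<Longrightarrow> E b b'"
    and no_co_bridge: "E a b \<Longrightarrow> E b c \<Longrightarrow> E c d \<Longrightarrow> E d a \<Longrightarrow> \<not> E a c \<Longrightarrow> \<not> E b d \<Longrightarrow>
      a \<noteq> c \<Longrightarrow> b \<noteq> d \<Longrightarrow> u \<in> V \<Longrightarrow> v \<in> V \<Longrightarrow> u \<noteq> v \<Longrightarrow> \<not> E u v \<Longrightarrow>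
      u \<notin> {a, b, c, d} \<Longrightarrow> v \<notin> {a, b, c, d} \<Longrightarrow>
      \<exists>w\<in>{u, v}. E w a \<or> E w b \<or> E w c \<or> E w d"
begin

lemma D_edges:
  assumes "D a b c"
  shows "E a b" "E b c" "E a c" "E b a" "E c b" "E c a"
  using assms D_edge D_rot E_sym by blast+

lemma D_distinct: "D a b c \<Longrightarrow> a \<noteq> b \<and> b \<noteq> c \<and> a \<noteq> c"
  using D_edges E_irrefl by metis

lemma D_V: "D a b c \<Longrightarrow> a \<in> V \<and> b \<in> V \<and> c \<in> V"
  using D_edges E_V by metis

lemma reverse: "oriented_prismatic V E (\<lambda>a b c. D a c b)"
proof
  show "E b b'" if d: "D a c b" "D a' c' b'" and e: "{a, b, c} \<inter> {a', b', c'} = {}" "E a a'" for a b c a' b' c'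
  proof -
    \<comment> \<open>One step backwards along the triangles is two steps forwards:
      \<open>match\<close> is applied twice.\<close>
    have "E c c'" using match[OF d] e by (simp add: insert_commute)
    then show ?thesis using match[OF d[THEN D_rot]] e by (simp add: insert_commute)
  qed
  show "v = c" if "D a c b" "E v a" "E v b" for a b c v
    using prism_uniq[OF D_rot[OF D_rot[OF that(1)]] that(3,2)] .
  show "D b a c" if "D a c b" for a b c
    using D_rot[OF D_rot[OF that]] .
  show "E v a \<or> E v b \<or> E v c" if "D a c b" "v \<in> V" "v \<notin> {a, b, c}" for a b c v
    using prism_ex[OF that(1,2)] that(3) by blast
  show "D a c b \<or> D a b c" if "E a b" "E b c" "E a c" for a b c
    using tri[OF that] by blast
  show "\<not> D a b c" if "D a c b" for a b c
    using D_asym[OF that] .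
qed (fact E_sym E_irrefl E_V D_edges(3) no_co_bridge)+

text \<open>Since \<open>u\<close>, \<open>v\<close>, \<open>a\<close> form a triangle, another
  vertex has only one neighbour in it; hence an edge lies in at most one triangle.\<close>

lemma common_nbr: "E u v \<Longrightarrow> E u a \<Longrightarrow> E v a \<Longrightarrow> E u b \<Longrightarrow> E v b \<Longrightarrow> a = b"
  using tri[of u v a] prism_uniq[of u v a b] prism_uniq[of v u a b] D_rot[of u a v] D_rot[of a v u] E_sym
  by blast

lemma nbr_D:
  assumes "D a b c" "E v a" "v \<noteq> b" "v \<noteq> c"
  shows "\<not> E v b" "\<not> E v c"
  using assms prism_uniq D_rot by metis+

lemma match':
  assumes "D a b c" "D a' b' c'" "{a, b, c} \<inter> {a', b', c'} = {}" "E a a'"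
  shows "E b b'" "E c c'"
proof -
  show *: "E b b'" using match[OF assms] .
  show "E c c'" using match[OF D_rot D_rot, OF assms(1,2) _ *] assms(3) by (simp add: insert_commute)
qed

text \<open>Reversing all orientations exchanges \<open>X\<close> and \<open>Y\<close>, and \<open>p\<close> and \<open>q\<close>; every statement about \<open>X\<close> below thus has
  a mirror image about \<open>Y\<close>.\<close>

abbreviation "out \<equiv> outer E D"

section \<open>Adjacency between a triangle avoiding \<open>b\<close> and the triangles at
  \<open>b\<close>\<close>

lemma outD:
  assumes "out b v p q"
  shows "D v p q" "E b v" "E v b" "b \<noteq> p" "b \<noteq> q" "\<not> E b p" "\<not> E b q" "\<not> E p b" "\<not> E q b" "b \<noteq> v" "b \<in> V"
  using assms nbr_D[of v p q b] E_sym E_irrefl E_V unfolding outer_def by blast+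

lemma out_cases:
  assumes "D u v w" "b \<in> V" "b \<notin> {u, v, w}"
  shows "out b u v w \<or> out b v w u \<or> out b w u v"
  using assms prism_ex[of u v w b] D_rot unfolding outer_def by auto

text \<open>The two triangles are disjoint, and the edge \<open>b v\<close> starts the matching
  between them; compatible orientations continue it with \<open>x p\<close> and
  \<open>y q\<close>.\<close>

lemma out_type:
  assumes "out b v p q" "D b x y" "v \<noteq> x" "v \<noteq> y"
  shows "E p x" "E q y" "\<not> E p y" "\<not> E q x" "p \<noteq> x" "p \<noteq> y" "q \<noteq> x" "q \<noteq> y" "\<not> E v x" "\<not> E v y"
proof -
  note o = outD[OF assms(1)]
  have ne: "p \<noteq> x" "p \<noteq> y" "q \<noteq> x" "q \<noteq> y" using o D_edges[OF assms(2)] by metis+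
  then show "p \<noteq> x" "p \<noteq> y" "q \<noteq> x" "q \<noteq> y" .
  have "{v, p, q} \<inter> {b, x, y} = {}" using o ne assms(3,4) by auto
  then show *: "E p x" "E q y" using match'[OF o(1) assms(2)] o by blast+
  show "\<not> E p y" "\<not> E q x" using * ne prism_uniq D_rot assms(2) o by metis+
  show "\<not> E v x" "\<not> E v y" using nbr_D[OF assms(2)] o assms by blast+
qed

lemma out_X_type:
  assumes "out b x p q" "D b x y"
  shows "E p x" "E q x" "\<not> E p y" "\<not> E q y" "p \<noteq> x" "p \<noteq> y" "q \<noteq> x" "q \<noteq> y"
proof -
  note o = outD[OF assms(1)]
  show "p \<noteq> x" "p \<noteq> y" "q \<noteq> x" "q \<noteq> y" using o D_edges[OF assms(2)] by metis+
  show *: "E p x" "E q x" using D_edges[OF o(1)] by blast+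
  show "\<not> E p y" "\<not> E q y" using * o nbr_D[OF D_rot[OF assms(2)]] \<open>p \<noteq> y\<close> \<open>q \<noteq> y\<close> by metis+
qed

lemma out_Y_type:
  assumes "out b y p q" "D b x y"
  shows "E q y" "E p y" "\<not> E q x" "\<not> E p x" "q \<noteq> y" "q \<noteq> x" "p \<noteq> y" "p \<noteq> x"
  using oriented_prismatic.out_X_type[OF reverse, OF outer_reverse[OF assms(1)] assms(2)] .

text \<open>The edge from \<open>b\<close> to a neighbour lies in only one triangle, and this
  triangle has one orientation. So \<open>x\<close> and \<open>y\<close> determine each other, and
  no vertex is both a successor and a predecessor of \<open>b\<close>.\<close>

lemma index_uniq:
  assumes "D b x y" "D b x' y'"
  shows "x = x' \<longleftrightarrow> y = y'" "x \<noteq> y'" "x' \<noteq> y"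
proof -
  show "x = x' \<longleftrightarrow> y = y'" using assms common_nbr D_edges by metis
  show "x \<noteq> y'" using assms common_nbr[of b x x' y] D_asym D_edges by metis
  show "x' \<noteq> y" using assms common_nbr[of b y x y'] D_asym D_edges by metis
qed

lemma nbr_index_nonadj:
  assumes "D b x y" "D b x' y'" "x \<noteq> x'"
  shows "\<not> E x x'" "\<not> E x y'" "\<not> E y x'" "\<not> E y y'"
  using assms index_uniq[OF assms(1,2)] nbr_D[OF assms(2)] D_edges[OF assms(1)] E_sym by metis+

text \<open>If \<open>p\<close> and \<open>p'\<close> differed, the triangles \<open>x p q\<close>
  and \<open>p' q' x'\<close> would be disjoint with \<open>x\<close> adjacent to \<open>p'\<close>.
  The matching then makes \<open>p\<close> adjacent to \<open>q'\<close>, but by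
  \<open>out_type\<close> it is already adjacent to \<open>x'\<close>.\<close>

lemma out_at_X:
  assumes "out b x p q" "out b x' p' q'" "D b x y" "D b x' y'" "x \<noteq> x'"
  shows "p = p'"
proof (rule ccontr)
  assume "p \<noteq> p'"
  note i = index_uniq[OF assms(3,4)]
  note a = out_type[OF assms(1,4,5) i(2)] out_X_type[OF assms(1,3)]
  note b = out_type[OF assms(2,3) assms(5)[symmetric] i(3)] out_X_type[OF assms(2,4)]
  have "p \<noteq> q'" "q \<noteq> p'" "q \<noteq> q'" using a b by blast+
  then have "{x, p, q} \<inter> {p', q', x'} = {}"
    using \<open>p \<noteq> p'\<close> a b assms(5) by auto
  moreover have "D p' q' x'" using outD(1)[OF assms(2)] by (rule D_rot)
  ultimately have "E p q'" using match[OF outD(1)[OF assms(1)]] E_sym[OF b(1)] by blast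
  moreover have "E p x'" using a by blast
  ultimately show False
    using prism_uniq[OF D_rot[OF D_rot[OF outD(1)[OF assms(2)]]]] \<open>p \<noteq> p'\<close> by blast
qed

lemma out_at_Y:
  assumes "out b y p q" "out b y' p' q'" "D b x y" "D b x' y'" "y \<noteq> y'"
  shows "q = q'"
  using oriented_prismatic.out_at_X[OF reverse, OF assms(1,2)[THEN outer_reverse] assms(3-)] .

lemma hitI:
  assumes "b \<in> V" "length xs \<le> 4"
    "\<And>v p q. out b v p q \<Longrightarrow> v \<in> set xs \<or> p \<in> set xs \<or> q \<in> set xs"
  shows "hit5 D"
  unfolding hit5_def
proof (intro exI[of _ "set (b # xs)"] conjI allI impI)
  show "card (set (b # xs)) \<le> 5" using card_length[of "b # xs"] assms(2) by simp
  fix u v w assume "D u v w"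
  then show "set (b # xs) \<inter> {u, v, w} \<noteq> {}"
    using out_cases[OF \<open>D u v w\<close> assms(1)] assms(3) by (cases "b \<in> {u, v, w}") (auto; blast)+
qed simp

section \<open>Triangles on one side only\<close>

lemma index_dichotomy:
  assumes "D b x y" "v \<in> V" "v \<noteq> b" "\<not> E b v"
  shows "E v x \<longleftrightarrow> \<not> E v y"
  using prism_ex[OF assms(1,2)] prism_uniq[OF D_rot[OF assms(1)]] assms D_edges[OF assms(1)] E_sym by blast

lemma out_triangle:
  assumes "E b v" "E v u" "E v w" "E u w" "\<not> E b u" "\<not> E b w" "b \<noteq> u" "b \<noteq> w"
  shows "out b v u w \<or> out b v w u"
  using tri[OF assms(2,4,3)] assms unfolding outer_def by blast

lemma one_side:
  assumes T1: "D b x1 y1" and T2: "D b x2 y2" and ne: "x1 \<noteq> x2"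
    and noX: "\<And>x y p q. D b x y \<Longrightarrow> \<not> out b x p q"
  shows "colorable3 V E \<or> hit5 D"
proof -
  have bV: "b \<in> V" using D_V[OF T1] by blast
  define X where "X = {x. \<exists>y. D b x y}"
  \<comment> \<open>The color classes are \<open>{b} \<union> P\<close>, \<open>Q \<union> X\<close> and \<open>C\<close>; only \<open>P\<close> can fail to be stable.\<close>
  define Q where "Q = {v\<in>V. v \<noteq> b \<and> \<not> E b v \<and> (\<forall>x y. D b x y \<longrightarrow> E v y)}"
  define P where "P = {v\<in>V. v \<noteq> b \<and> \<not> E b v \<and> v \<notin> Q}"
  define C where "C = {v. E b v} - X"
  have yne: "y1 \<noteq> y2" using index_uniq(1)[OF T1 T2] ne by blast
  have role_q: "E q y" if "out b v p q" "D b x y" for v p q x y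
    using out_type(2)[OF that] out_Y_type(1)[of b v p q x] noX that by blast
  have q_in_Q: "q \<in> Q" if "out b v p q" for v p q
    using role_q[OF that] outD[OF that] D_V[OF outD(1)[OF that]] unfolding Q_def by blast
  have stable_C: "\<not> E u v" if "u \<in> C" "v \<in> C" for u v
    using tri[of b u v] that unfolding C_def X_def by blast
  have stable_Q: "\<not> E u v" if "u \<in> Q" "v \<in> Q" for u v
    using common_nbr[of u v y1 y2] that T1 T2 yne unfolding Q_def by blast
  have Q_X: "\<not> E u x" if "u \<in> Q" "x \<in> X" for u x
    using index_dichotomy[of b x _ u] that unfolding Q_def X_def by blast
  have stable_X: "\<not> E u v" if "u \<in> X" "v \<in> X" for u v
    using nbr_index_nonadj(1)[of b u _ v] that E_irrefl unfolding X_def by blast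
  show ?thesis
  proof (cases "\<exists>u\<in>P. \<exists>u'\<in>P. E u u'")
    case False
    have "colorable3 V E"
    proof (rule colorable3I[of V "{b} \<union> P" "Q \<union> X" C])
      show "V \<subseteq> {b} \<union> P \<union> (Q \<union> X) \<union> C" unfolding P_def C_def by blast
      show "\<not> E u v" if "u \<in> {b} \<union> P" "v \<in> {b} \<union> P" for u v
      proof
        assume "E u v"
        then have "u \<notin> P \<or> v \<notin> P" using False by blast
        then show False using \<open>E u v\<close> E_irrefl[of b] E_sym[of u v] that unfolding P_def by blast
      qed
      show "\<not> E u v" if "u \<in> Q \<union> X" "v \<in> Q \<union> X" for u v
        using stable_Q[of u v] Q_X[of u v] Q_X[of v u] stable_X[of u v] E_sym[of u v] that by blast
      show "\<not> E u v" if "u \<in> C" "v \<in> C" for u v using stable_C that .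
    qed
    then show ?thesis ..
  next
    case True
    then obtain u0 u0' where u0: "u0 \<in> P" "u0' \<in> P" "E u0 u0'" by blast
    have X_nbr: "\<exists>x y. D b x y \<and> E u x" if "u \<in> P" for u
      using that index_dichotomy[of b _ _ u] unfolding P_def Q_def by blast
    have P_b: "u \<in> V" "u \<noteq> b" "b \<noteq> u" "\<not> E b u" "u \<notin> Q" if "u \<in> P" for u
      using that unfolding P_def by auto
    have dich: "E u x \<longleftrightarrow> \<not> E u y" if "D b x y" "u \<in> P" for u x y
      using index_dichotomy[OF that(1) P_b(1,2,4)[OF that(2)]] .
    have no_common: "\<not> E u x \<or> \<not> E u' x" if "D b x y" "\<not> E b u" "\<not> E b u'" "E u u'" "b \<noteq> u" "b \<noteq> u'" for u u' x y
      using out_triangle[of b x u u'] noX[OF that(1)] that D_edges[OF that(1)] E_sym by blast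
    \<comment> \<open>A common neighbour in \<open>X\<close> would give an excluded triangle. If
      both ends miss \<open>x\<close>, both see \<open>y\<close>, and the triangle on
      \<open>y\<close>, \<open>u\<close>, \<open>u'\<close> has its last vertex in \<open>Q\<close>,
      which \<open>P\<close> excludes.\<close>
    have compl: "E u x \<longleftrightarrow> \<not> E u' x" if "D b x y" "u \<in> P" "u' \<in> P" "E u u'" for u u' x y
    proof -
      have "E u x \<or> E u' x"
      proof (rule ccontr)
        assume "\<not> ?thesis"
        then have "E u y" "E u' y"
          using dich[OF that(1)] that(2,3) by blast+
        then have "out b y u u' \<or> out b y u' u"
          using out_triangle[OF D_edges(3)[OF that(1)] E_sym E_sym that(4)] P_b(3,4)[OF that(2)] P_b(3,4)[OF that(3)]
          by blast
        then show False using q_in_Q[of y] P_b(5)[OF that(2)] P_b(5)[OF that(3)] by blast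
      qed
      then show ?thesis 
        using no_common[OF that(1) P_b(4)[OF that(2)] P_b(4)[OF that(3)] that(4) P_b(3)[OF that(2)] P_b(3)[OF that(3)]]
        by blast
    qed
    have Y_nbr: "\<exists>x y. D b x y \<and> E u y" if u: "u \<in> P" "u' \<in> P" "E u u'" for u u'
    proof -
      obtain x y where xy: "D b x y" "E u' x" using X_nbr u by blast
      then have "\<not> E u x" using compl[OF xy(1) u] by blast
      then show ?thesis using dich[OF xy(1) u(1)] xy(1) by blast
    qed
    \<comment> \<open>\<open>p\<close> is complete to \<open>X\<close>, so \<open>no_common\<close>
      keeps \<open>u\<close> away from it. \<open>q\<close> is complete to \<open>Y\<close>, so a
      neighbour \<open>u\<close> of \<open>q\<close> forms a triangle with some \<open>y\<close>,
      and \<open>u\<close> cannot come last there as it is not in \<open>Q\<close>.\<close>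
    have Z_tri: "(\<exists>x y. D b x y \<and> out b y u q) \<or> (\<not> E u p \<and> \<not> E u q)"
      if o: "out b z p q" and z: "\<And>x y. D b x y \<Longrightarrow> z \<noteq> x \<and> z \<noteq> y"
        and u: "u \<in> P" "u' \<in> P" "E u u'" for u u' z p q
    proof -
      note t = out_type[OF o]
      obtain x y where xy: "D b x y" "E u x" using X_nbr u by blast
      have "\<not> E u p"
        using no_common[OF xy(1) P_b(4)[OF u(1)] outD(6)[OF o] _ P_b(3)[OF u(1)] outD(4)[OF o]]
          t(1)[OF xy(1)] z[OF xy(1)] xy(2) by blast
      moreover have "\<exists>x y. D b x y \<and> out b y u q" if uq: "E u q"
      proof -
        obtain x y where xy: "D b x y" "E u y" using Y_nbr[OF u] by blast
        have "E q y" using role_q[OF o xy(1)] .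
        then have "out b y u q \<or> out b y q u"
          using out_triangle[OF D_edges(3)[OF xy(1)] E_sym[OF xy(2)] E_sym uq P_b(4)[OF u(1)] outD(7)[OF o]
              P_b(3)[OF u(1)] outD(5)[OF o]] by blast
        then show ?thesis using q_in_Q[of y q u] P_b(5)[OF u(1)] xy(1) by blast
      qed
      ultimately show ?thesis by blast
    qed
    \<comment> \<open>Otherwise both \<open>u0\<close> and \<open>u0'\<close> miss \<open>p\<close>
      and \<open>q\<close>, so both see \<open>z\<close> and form a triangle with it, whose last
      vertex would lie in \<open>Q\<close>.\<close>
    have Z_tri': "\<exists>x y s. s \<in> {u0, u0'} \<and> D b x y \<and> out b y s q"
      if o: "out b z p q" and z: "\<And>x y. D b x y \<Longrightarrow> z \<noteq> x \<and> z \<noteq> y" for z p q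
    proof (rule ccontr)
      assume neg: "\<not> ?thesis"
      have not_p: "u \<noteq> p" if u: "u \<in> P" "u' \<in> P" "E u u'" for u u'
      proof
        assume "u = p"
        obtain x y where xy: "D b x y" "E u' x" using X_nbr u by blast
        then have "E u x" using out_type(1)[OF o xy(1)] z[OF xy(1)] \<open>u = p\<close> by blast
        then show False using compl[OF xy(1) u] xy by blast
      qed
      have adj_z: "E u z" if u: "u \<in> P" "u' \<in> P" "E u u'" "u \<in> {u0, u0'}" for u u'
      proof -
        have "\<not> E u p \<and> \<not> E u q" using Z_tri[OF o z u(1-3)] neg u(4) by blast
        moreover have "u \<notin> {z, p, q}"
          using not_p[OF u(1-3)] q_in_Q[OF o] P_b(4,5)[OF u(1)] outD(2)[OF o] by blast
        ultimately show ?thesis using prism_ex[OF outD(1)[OF o] P_b(1)[OF u(1)]] by blast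
      qed
      have "E z u0" "E z u0'"
        using E_sym[OF adj_z[OF u0]] E_sym[OF adj_z[OF u0(2,1) E_sym[OF u0(3)]]] by blast+
      then have "out b z u0 u0' \<or> out b z u0' u0"
        using out_triangle[OF outD(2)[OF o] _ _ u0(3)] P_b(3,4)[OF u0(1)] P_b(3,4)[OF u0(2)] by blast
      moreover have False if "out b z u u'" "u \<in> P" "u' \<in> P" for u u'
        using q_in_Q[OF that(1)] P_b(5) that by blast
      ultimately show False using u0 by blast
    qed
    have not_both: False if "D b x y" "D b x' y'" "out b y u q" "out b y' u' q'" "u \<in> P" "u' \<in> P" "E u u'"
      for x y x' y' u u' q q'
    proof (cases "y = y'")
      case True
      then have "E u y" "E u' y" using out_Y_type(2)[OF that(3,1)] out_Y_type(2)[OF that(4,2)] by blast+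
      then show False 
        using compl[OF that(1,5-7)] dich[OF that(1,5)] dich[OF that(1,6)] by blast
    next
      case False
      then have "E u' q" using out_at_Y[OF that(3,4,1,2)] D_edges[OF outD(1)[OF that(4)]] by blast
      then have "u' = y"
        using prism_uniq[OF D_rot[OF outD(1)[OF that(3)]]] that(7) E_sym by blast
      then show False using D_edges(3)[OF that(1)] P_b(4)[OF that(6)] by blast
    qed
    have uniq_q: "q = q'" if "D b x y" "D b x' y'" "out b y u q" "out b y' u q'" for x y x' y' u q q'
      using out_at_Y[OF that(3,4,1,2)] common_nbr[OF D_edges(1,3,2)[OF outD(1)[OF that(3)]], of q']
        D_edges(2,3)[OF outD(1)[OF that(4)]] by blast
    \<comment> \<open>By \<open>not_both\<close> only one of \<open>u0\<close>, \<open>u0'\<close>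
      can be the \<open>s\<close> of \<open>Z_tri'\<close>, and by \<open>uniq_q\<close> it
      determines \<open>q\<close>. Triangles at different vertices of \<open>Y\<close> share their
      last vertex by \<open>out_at_Y\<close>. Hence \<open>b\<close>, \<open>y\<close>,
      \<open>q\<close> hit everything.\<close>
    obtain y q where yq: "\<And>v p' q'. out b v p' q' \<Longrightarrow> v = y \<or> q' = q"
    proof (cases "\<exists>z p q. out b z p q \<and> (\<forall>x y. D b x y \<longrightarrow> z \<noteq> x \<and> z \<noteq> y)")
      case True
      then obtain z p q where o: "out b z p q" and "\<And>x y. D b x y \<Longrightarrow> z \<noteq> x \<and> z \<noteq> y" by blast
      from Z_tri'[OF this] obtain x y s where s: "s \<in> {u0, u0'}" "D b x y" "out b y s q" by blast
      have "v = y \<or> q' = q" if o: "out b v p' q'" for v p' q'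
      proof (cases "\<exists>x y. D b x y \<and> (v = x \<or> v = y)")
        case True
        then obtain x' where "D b x' v" using noX[of v _ p' q'] o by blast
        then show ?thesis using out_at_Y[OF o s(3) _ s(2)] by blast
      next
        case False
        then have "\<And>x y. D b x y \<Longrightarrow> v \<noteq> x \<and> v \<noteq> y" by blast
        from Z_tri'[OF o this] obtain x' y' s' where s': "s' \<in> {u0, u0'}" "D b x' y'" "out b y' s' q'"
          by blast
        then have "s' = s" 
            using not_both[OF s(2) s'(2) s(3) s'(3)] s(1) u0 E_sym[OF u0(3)] by auto
        then show ?thesis using uniq_q[OF s(2) s'(2) s(3), of q'] s'(3) by blast
      qed
      then show ?thesis using that by blast
    next
      case False
      show ?thesis
      proof (cases "\<exists>x y p q. D b x y \<and> out b y p q")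
        case True
        then obtain x y p q where y: "D b x y" "out b y p q" by blast
        have "v = y \<or> q' = q" if o: "out b v p' q'" for v p' q'
        proof -
          obtain x' where "D b x' v" using noX[of v _ p' q'] o False by blast
          then show ?thesis using out_at_Y[OF o y(2) _ y(1)] by blast
        qed
        then show ?thesis using that by blast
      next
        case no: False
        have "\<not> out b v p' q'" for v p' q'
        proof
          assume o: "out b v p' q'"
          with False obtain x y where xy: "D b x y" "v = x \<or> v = y" by blast
          with o no noX[of x y p' q'] show False by blast
        qed
        then show ?thesis using that by blast
      qed
    qed
    have "hit5 D" by (rule hitI[OF bV, of "[y, q]"]) (use yq in auto)
    then show ?thesis ..
  qed
qed

section \<open>Triangles on both sides\<close>

text \<open>\<open>p1\<close> is complete to \<open>X\<close>, so the edge \<open>x p1\<close>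
  starts a matching between the triangles \<open>x p q\<close> and \<open>p1 q1 z\<close>, which
  continues with \<open>p q1\<close> and \<open>q z\<close>. The second triangle at \<open>b\<close>
  shows that \<open>q\<close> and \<open>p1\<close> differ: \<open>x'\<close> is adjacent to
  \<open>p1\<close> but not to \<open>q\<close>.\<close>

lemma Z_adj:
  assumes ix: "D b x y" "D b x' y'" "x \<noteq> x'" and o: "out b x p q"
    and oz: "out b z p1 q1" and z: "\<And>x y. D b x y \<Longrightarrow> z \<noteq> x \<and> z \<noteq> y" and ne: "p1 \<noteq> p"
  shows "E z q" "E p q1"
proof -
  note t = out_type[OF oz ix(1)] out_type[OF oz ix(2)]
  note s = out_X_type[OF o ix(1)] out_type[OF o ix(2,3) index_uniq(2)[OF ix(1,2)]]
  have "q \<noteq> p1" "p \<noteq> q1" "q \<noteq> q1" using t s z ix by metis+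
  moreover have "x \<noteq> z" using z[OF ix(1)] by blast
  ultimately have disj: "{x, p, q} \<inter> {p1, q1, z} = {}"
    using ne outD(2,6,7)[OF o] outD(2,6,7)[OF oz] by auto
  have "E x p1" using t(1) z[OF ix(1)] E_sym by blast
  then show "E p q1" "E z q"
    using match'[OF outD(1)[OF o] D_rot[OF outD(1)[OF oz]] disj] E_sym by blast+
qed

lemma Z_adj':
  assumes ix: "D b x y" "D b x' y'" "y \<noteq> y'" and o: "out b y p q"
    and oz: "out b z p1 q1" and z: "\<And>x y. D b x y \<Longrightarrow> z \<noteq> x \<and> z \<noteq> y" and ne: "q1 \<noteq> q"
  shows "E z p" "E q p1"
proof -
  have z': "z \<noteq> u \<and> z \<noteq> v" if "D b v u" for u v using z[OF that] by blast
  show "E z p" "E q p1"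
    using oriented_prismatic.Z_adj[OF reverse, OF ix outer_reverse[OF o] outer_reverse[OF oz] z' ne] by blast+
qed

text \<open>If \<open>z\<close> and \<open>q2\<close> were nonadjacent, the 4-cycle \<open>b z q x\<close> and the vertices \<open>q'\<close>, \<open>q2\<close> would induce a
  co-bridge.\<close>

lemma Z_common_half:
  assumes ix: "D b x y" "D b x' y'" "x \<noteq> x'"
    and oX: "out b x p q" and oY: "out b y' p' q'" and qp: "q \<noteq> p'"
    and oz: "out b z p1 q1" and z: "\<And>x y. D b x y \<Longrightarrow> z \<noteq> x \<and> z \<noteq> y" and ne1: "p1 \<noteq> p" "q1 \<noteq> q'"
    and ow: "out b w p2 q2" and w: "\<And>x y. D b x y \<Longrightarrow> w \<noteq> x \<and> w \<noteq> y" and ne2: "p2 \<noteq> p" "q2 \<noteq> q'"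
  shows "E z q2"
proof (rule ccontr)
  assume no: "\<not> E z q2"
  note i = index_uniq[OF ix(1,2)]
  have zx: "z \<noteq> x" "z \<noteq> y" "z \<noteq> x'" "z \<noteq> y'" "w \<noteq> x" "w \<noteq> y" "w \<noteq> x'" "w \<noteq> y'"
    using z w ix by blast+
  have yy: "y' \<noteq> x" "y' \<noteq> y" using i ix(3) by blast+
  note tX = out_X_type[OF oX ix(1)] out_type[OF oX ix(2,3) i(2)]
  note tY = out_type[OF oY ix(1) yy]
  note tz = out_type[OF oz ix(1) zx(1,2)] out_type[OF oz ix(2) zx(3,4)]
  note tw = out_type[OF ow ix(1) zx(5,6)] out_type[OF ow ix(2) zx(7,8)]
  \<comment> \<open>The first edge closes the 4-cycle. By the second, \<open>q\<close> already has
    its neighbour \<open>w\<close> in the triangle \<open>w p2 q2\<close>, so \<open>q\<close> and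
    \<open>q2\<close> are nonadjacent.\<close>
  have zq: "E z q" "E w q" using Z_adj[OF ix oX oz z ne1(1)] Z_adj[OF ix oX ow w ne2(1)] by blast+
  have zp': "E z p'" using Z_adj'[OF ix(2,1) yy(2) oY oz z ne1(2)] by blast
  have zxn: "\<not> E z x" using tz by blast
  note DX = outD(1)[OF oX] and DY = outD(1)[OF oY] and Dw = outD(1)[OF ow]
  have q'z: "\<not> E q' z" using prism_uniq[OF D_rot[OF DY] zp'] zx(4) E_sym[of q' z] by blast
  have q'q: "\<not> E q' q"
    using prism_uniq[OF D_rot[OF D_rot[OF DY]], of q] tX qp E_sym[of q' q] by blast
  have q2p': "q2 \<noteq> p'" using tY tw by blast
  have q'q2: "\<not> E q' q2"
    using prism_uniq[OF D_rot[OF D_rot[OF DY]], of q2] tw q2p' E_sym[of q' q2] by blast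
  have "q \<noteq> p2" using tX tw by blast
  then have q2q: "\<not> E q2 q"
    using prism_uniq[OF D_rot[OF D_rot[OF Dw]], of q] E_sym[OF zq(2)] E_sym[of q2 q] by blast
  have "\<exists>v\<in>{q', q2}. E v b \<or> E v z \<or> E v q \<or> E v x"
  proof (rule no_co_bridge)
    show "E b z" "E z q" "E q x" "E x b" using outD[OF oz] zq tX outD(3)[OF oX] by blast+
    show "\<not> E b q" "\<not> E z x" "b \<noteq> q" "z \<noteq> x" using outD[OF oX] zxn zx by blast+
    show "q' \<in> V" "q2 \<in> V" using D_V[OF DY] D_V[OF Dw] by blast+
    show "q' \<noteq> q2" "\<not> E q' q2" using ne2 q'q2 by blast+
    have "q' \<noteq> b" "q' \<noteq> z" "q' \<noteq> q" "q' \<noteq> x"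
      using outD(5,7)[OF oY] outD(2)[OF oz] tX tY by blast+
    then show "q' \<notin> {b, z, q, x}" by simp
    have "q2 \<noteq> b" "q2 \<noteq> z" "q2 \<noteq> q" "q2 \<noteq> x"
      using outD(5,7)[OF ow] outD(2)[OF oz] tX tw by blast+
    then show "q2 \<notin> {b, z, q, x}" by simp
  qed
  moreover have "\<not> E q' b" "\<not> E q' x" "\<not> E q2 b" "\<not> E q2 x" "\<not> E q2 z"
    using outD(9)[OF oY] outD(9)[OF ow] tY tw no E_sym[of q2 z] by blast+
  ultimately show False using q'z q'q q2q by blast
qed

text \<open>\<open>Z_common_half\<close> and its mirror image make \<open>z\<close> adjacent to both
  \<open>q2\<close> and \<open>p2\<close>, and only \<open>w\<close> completes that edge to a
  triangle.\<close>

lemma Z_common: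
  assumes ix: "D b x y" "D b x' y'" "x \<noteq> x'"
    and oX: "out b x p q" and oY: "out b y' p' q'" and qp: "q \<noteq> p'"
    and oz: "out b z p1 q1" and z: "\<And>x y. D b x y \<Longrightarrow> z \<noteq> x \<and> z \<noteq> y" and ne1: "p1 \<noteq> p" "q1 \<noteq> q'"
    and ow: "out b w p2 q2" and w: "\<And>x y. D b x y \<Longrightarrow> w \<noteq> x \<and> w \<noteq> y" and ne2: "p2 \<noteq> p" "q2 \<noteq> q'"
  shows "z = w"
proof -
  have z': "z \<noteq> u \<and> z \<noteq> v" if "D b v u" for u v using z[OF that] by blast
  have w': "w \<noteq> u \<and> w \<noteq> v" if "D b v u" for u v using w[OF that] by blast
  have yy: "y' \<noteq> y" using index_uniq[OF ix(1,2)] ix(3) by blast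
  have "E z q2" using Z_common_half[OF assms] .
  moreover have "E z p2"
    using oriented_prismatic.Z_common_half[OF reverse, OF ix(2,1) yy outer_reverse[OF oY] outer_reverse[OF oX]
        qp[symmetric] outer_reverse[OF oz] z' ne1(2,1) outer_reverse[OF ow] w' ne2(2,1)] by blast
  ultimately show ?thesis using prism_uniq[OF D_rot[OF outD(1)[OF ow]]] by blast
qed

lemma out_at_index:
  assumes ix: "D b x y" and oX: "out b x p q" and oY: "out b y p' q'"
  shows "E p p'" "E q q'"
proof -
  note s = out_X_type[OF oX ix] and s' = out_Y_type[OF oY ix]
  have "p \<noteq> p'" "p \<noteq> q'" "q \<noteq> p'" "q \<noteq> q'" using s s' by blast+
  moreover have "x \<noteq> y" using D_distinct[OF ix] by blast
  ultimately have "{x, p, q} \<inter> {y, p', q'} = {}" using s s' by auto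
  then show "E p p'" "E q q'"
    using match'[OF outD(1)[OF oX] outD(1)[OF oY]] D_edges[OF ix] by blast+
qed

text \<open>Triangles at different vertices of \<open>X\<close> share their middle vertex by
  \<open>out_at_X\<close>. So a second middle vertex forces all of them to sit at \<open>x\<close>.
  In both cases one vertex, \<open>p\<close> or \<open>x\<close>, hits every outer triangle at
  \<open>X\<close>.\<close>

lemma out_X_alternative:
  assumes "D b x y" "out b x p q"
  obtains (one) "\<And>u v r s. D b u v \<Longrightarrow> out b u r s \<Longrightarrow> r = p"
  | (two) p' q' where "out b x p' q'" "p' \<noteq> p" "\<And>u v r s. D b u v \<Longrightarrow> out b u r s \<Longrightarrow> u = x"
proof (cases "\<exists>u v r s. D b u v \<and> out b u r s \<and> r \<noteq> p")
  case False
  then show ?thesis using one by blast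
next
  case True
  then obtain u v p' q' where u: "D b u v" "out b u p' q'" "p' \<noteq> p" by blast
  then have "u = x" using out_at_X[OF assms(2) u(2) assms(1) u(1)] by blast
  moreover have "w = x" if "D b w y'" "out b w r s" for w y' r s
  proof (rule ccontr)
    assume "w \<noteq> x"
    then have "p = r" "p' = r"
      using out_at_X[OF assms(2) that(2) assms(1) that(1)] out_at_X[OF u(2) that(2) u(1) that(1)] \<open>u = x\<close> by blast+
    then show False using u by blast
  qed
  ultimately show ?thesis using two[of p' q'] u by blast
qed

lemma out_Y_alternative:
  assumes "D b x y" "out b y p q"
  obtains (one) "\<And>u v r s. D b u v \<Longrightarrow> out b v r s \<Longrightarrow> s = q"
  | (two) p' q' where "out b y p' q'" "q' \<noteq> q" "\<And>u v r s. D b u v \<Longrightarrow> out b v r s \<Longrightarrow> v = y"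
proof (rule oriented_prismatic.out_X_alternative[OF reverse, OF assms(1) outer_reverse[OF assms(2)]])
  assume *: "\<And>u v r s. D b v u \<Longrightarrow> outer E (\<lambda>a b c. D a c b) b u r s \<Longrightarrow> r = q"
  show thesis by (rule one) (rule *[OF _ outer_reverse])
next
  fix p' q' assume *: "outer E (\<lambda>a b c. D a c b) b y p' q'" "p' \<noteq> q"
    "\<And>u v r s. D b v u \<Longrightarrow> outer E (\<lambda>a b c. D a c b) b u r s \<Longrightarrow> u = y"
  show thesis
  proof (rule two)
    show "out b y q' p'" using *(1) by (simp add: outer_def)
    show "p' \<noteq> q" by (fact *(2))
    show "v = y" if "D b u v" "out b v r s" for u v r s using *(3)[OF that(1) outer_reverse[OF that(2)]] .
  qed
qed

text \<open>The budget of five: \<open>b\<close>, then \<alpha> and \<beta> for the outer triangles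
  at \<open>X\<close> and \<open>Y\<close>, and two more vertices \<open>xs\<close> for the
  triangles whose neighbour of \<open>b\<close> lies in neither set.\<close>

lemma hit_cases:
  assumes "D b x y" "length xs \<le> 2"
    and X: "\<And>u v r s. D b u v \<Longrightarrow> out b u r s \<Longrightarrow> {\<alpha>, \<beta>} \<inter> {u, r, s} \<noteq> {}"
    and Y: "\<And>u v r s. D b u v \<Longrightarrow> out b v r s \<Longrightarrow> {\<alpha>, \<beta>} \<inter> {v, r, s} \<noteq> {}"
    and Z: "\<And>z p q. out b z p q \<Longrightarrow> (\<And>x y. D b x y \<Longrightarrow> z \<noteq> x \<and> z \<noteq> y) \<Longrightarrow>
      ({\<alpha>, \<beta>} \<union> set xs) \<inter> {z, p, q} \<noteq> {}"
  shows "hit5 D"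
proof (rule hitI)
  show "b \<in> V" using D_V[OF assms(1)] by blast
  show "length ([\<alpha>, \<beta>] @ xs) \<le> 4" using assms(2) by simp
  fix v p q assume o: "out b v p q"
  consider (X) w where "D b v w" | (Y) w where "D b w v" | (Z) "\<And>x y. D b x y \<Longrightarrow> v \<noteq> x \<and> v \<noteq> y"
    by blast
  then have "({\<alpha>, \<beta>} \<union> set xs) \<inter> {v, p, q} \<noteq> {}"
  proof cases
    case X then show ?thesis using assms(3)[OF X o] by blast
  next
    case Y then show ?thesis using assms(4)[OF Y o] by blast
  next
    case Z then show ?thesis using assms(5)[OF o Z] by blast
  qed
  then show "v \<in> set ([\<alpha>, \<beta>] @ xs) \<or> p \<in> set ([\<alpha>, \<beta>] @ xs) \<or> q \<in> set ([\<alpha>, \<beta>] @ xs)" by auto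
qed

text \<open>A triangle attached outside \<open>X\<close> and \<open>Y\<close> contains
  \<open>p\<close>, or contains \<open>q'\<close>, or passes through one fixed \<open>z0\<close> by
  \<open>Z_common\<close>. One of \<open>p\<close>, \<open>q'\<close> is already among \<alpha>,
  \<beta>, so the other one, \<open>c\<close>, and \<open>z0\<close> fill the budget.\<close>

lemma hit_two_sided:
  assumes ix: "D b x y" "D b x' y'" "x \<noteq> x'"
    and oX: "out b x p q" and oY: "out b y' p' q'" and qp: "q \<noteq> p'"
    and X: "\<And>u v r s. D b u v \<Longrightarrow> out b u r s \<Longrightarrow> {\<alpha>, \<beta>} \<inter> {u, r, s} \<noteq> {}"
    and Y: "\<And>u v r s. D b u v \<Longrightarrow> out b v r s \<Longrightarrow> {\<alpha>, \<beta>} \<inter> {v, r, s} \<noteq> {}"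
    and pq: "p \<in> {\<alpha>, \<beta>} \<or> q' \<in> {\<alpha>, \<beta>}"
  shows "hit5 D"
proof -
  obtain c where c: "{p, q'} \<subseteq> {\<alpha>, \<beta>, c}" using pq by blast
  obtain z0 where z0: "z = z0" if "out b z p1 q1" "\<And>x y. D b x y \<Longrightarrow> z \<noteq> x \<and> z \<noteq> y" "p1 \<noteq> p" "q1 \<noteq> q'" for z p1 q1
  proof (cases "\<exists>z p1 q1. out b z p1 q1 \<and> (\<forall>x y. D b x y \<longrightarrow> z \<noteq> x \<and> z \<noteq> y) \<and> p1 \<noteq> p \<and> q1 \<noteq> q'")
    case True
    then obtain w p2 q2 where w: "out b w p2 q2" "\<And>x y. D b x y \<Longrightarrow> w \<noteq> x \<and> w \<noteq> y" "p2 \<noteq> p" "q2 \<noteq> q'" by blast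
    show ?thesis
      by (rule that[of w]) (rule Z_common[OF ix oX oY qp _ _ _ _ w])
  next
    case False
    then show ?thesis using that by blast
  qed
  have "({\<alpha>, \<beta>} \<union> set [c, z0]) \<inter> {z, p1, q1} \<noteq> {}"
    if "out b z p1 q1" "\<And>x y. D b x y \<Longrightarrow> z \<noteq> x \<and> z \<noteq> y" for z p1 q1
    using z0[OF that] c by auto
  with hit_cases[OF ix(1) _ X Y, of "[c, z0]"] show ?thesis by simp
qed

lemma two_sided_three:
  assumes third: "\<And>x y x' y'. D b x y \<Longrightarrow> D b x' y' \<Longrightarrow> \<exists>x'' y''. D b x'' y'' \<and> x'' \<noteq> x \<and> x'' \<noteq> x'"
    and X: "D b x y" "out b x p q" and Y: "D b x' y'" "out b y' p' q'"
  shows "hit5 D"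
proof -
  \<comment> \<open>If the two outer triangles sat at the same triangle of \<open>b\<close>, the
    adjacent vertices \<open>s\<close> and \<open>s'\<close> would both see the predecessors
    \<open>v2\<close>, \<open>v3\<close> of two further triangles, against
    \<open>common_nbr\<close>.\<close>
  have diff: "u \<noteq> u'" if d: "D b u v" "out b u r s" "D b u' v'" "out b v' r' s'" for u v r s u' v' r' s'
  proof
    assume "u = u'"
    then have v: "v = v'" using index_uniq[OF that(1,3)] by blast
    obtain u2 v2 where 2: "D b u2 v2" "u2 \<noteq> u" using third[OF d(1,1)] by blast
    obtain u3 v3 where 3: "D b u3 v3" "u3 \<noteq> u" "u3 \<noteq> u2" using third[OF d(1) 2(1)] by blast
    have adj: "E s b2 \<and> E s' b2" if "D b a2 b2" "a2 \<noteq> u" for a2 b2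
      using out_type(2)[OF \<open>out b u r s\<close> that(1)] out_type(2)[OF \<open>out b v' r' s'\<close> that(1)] that
        index_uniq[OF \<open>D b u v\<close> that(1)] v by blast
    have "E s s'" using out_at_index(2)[OF that(1,2)] that(4) v by blast
    then have "v2 = v3" using common_nbr[of s s' v2 v3] adj[OF 2] adj[OF 3(1,2)] by blast
    then show False using index_uniq(1)[OF 2(1) 3(1)] 3(3) by blast
  qed
  \<comment> \<open>A third triangle at \<open>b\<close> separates the two: its successor sees
    \<open>r'\<close> but not \<open>s\<close>.\<close>
  have ne: "s \<noteq> r'" if d: "D b u v" "out b u r s" "D b u' v'" "out b v' r' s'" for u v r s u' v' r' s'
  proof -
    obtain u2 v2 where 2: "D b u2 v2" "u2 \<noteq> u" "u2 \<noteq> u'" using third[OF d(1,3)] by blast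
    have "\<not> E s u2" "E r' u2"
      using out_type(4)[OF that(2) 2(1)] out_type(1)[OF that(4) 2(1)] 2(2,3)
        index_uniq[OF that(1) 2(1)] index_uniq[OF that(3) 2(1)] by blast+
    then show ?thesis by blast
  qed
  note sh = hit_two_sided[OF X(1) Y(1) diff[OF X Y] X(2) Y(2) ne[OF X Y]]
  show ?thesis
  proof (rule out_X_alternative[OF X])
    assume oneX: "\<And>u v r s. D b u v \<Longrightarrow> out b u r s \<Longrightarrow> r = p"
    obtain \<beta> where \<beta>: "\<And>u v r s. D b u v \<Longrightarrow> out b v r s \<Longrightarrow> \<beta> \<in> {v, r, s}"
      by (rule out_Y_alternative[OF Y]) blast+
    show ?thesis
    proof (rule sh[of p \<beta>])
      show "{p, \<beta>} \<inter> {u, r, s} \<noteq> {}" if "D b u v" "out b u r s" for u v r s using oneX[OF that] by simp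
      show "{p, \<beta>} \<inter> {v, r, s} \<noteq> {}" if "D b u v" "out b v r s" for u v r s using \<beta>[OF that] by blast
    qed simp
  next
    fix pa qa assume A: "out b x pa qa" "pa \<noteq> p" and allX: "\<And>u v r s. D b u v \<Longrightarrow> out b u r s \<Longrightarrow> u = x"
    show ?thesis
    proof (rule out_Y_alternative[OF Y])
      assume oneY: "\<And>u v r s. D b u v \<Longrightarrow> out b v r s \<Longrightarrow> s = q'"
      show ?thesis
      proof (rule sh[of x q'])
        show "{x, q'} \<inter> {u, r, s} \<noteq> {}" if "D b u v" "out b u r s" for u v r s using allX[OF that] by simp
        show "{x, q'} \<inter> {v, r, s} \<noteq> {}" if "D b u v" "out b v r s" for u v r s using oneY[OF that] by simp
      qed simp
    next
      fix pb qb assume B: "out b y' pb qb" "qb \<noteq> q'" and allY: "\<And>u v r s. D b u v \<Longrightarrow> out b v r s \<Longrightarrow> v = y'"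
      \<comment> \<open>With two middle vertices \<open>p\<close>, \<open>pa\<close> available at
        \<open>x\<close>, one of them differs from \<open>p2\<close>, and \<open>p1\<close> avoids
        both; this one is used in \<open>Z_common\<close>.\<close>
      have common: "z = w"
        if "out b z p1 q1" "\<And>x y. D b x y \<Longrightarrow> z \<noteq> x \<and> z \<noteq> y" "out b w p2 q2" "\<And>x y. D b x y \<Longrightarrow> w \<noteq> x \<and> w \<noteq> y"
          "p1 \<notin> {p, pa}" "q1 \<noteq> e" "q2 \<noteq> e" "e \<in> {q', qb}" for z w p1 q1 p2 q2 e
      proof -
        obtain c d where c: "out b x c d" "c \<in> {p, pa}" "p2 \<noteq> c" using A X(2) by blast
        obtain f where f: "out b y' f e" using B Y(2) \<open>e \<in> {q', qb}\<close> by blast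
        show ?thesis
          by (rule Z_common[OF X(1) Y(1) diff[OF X Y] c(1) f ne[OF X(1) c(1) Y(1) f] that(1,2) _ that(6) that(3,4)])
            (use c that in auto)
      qed
      \<comment> \<open>If all these triangles have their middle vertex in \<open>{p, pa}\<close>,
        that pair hits them. Otherwise an exception \<open>z0 p0 q0\<close> is fixed and
        \<open>e\<close> is chosen among \<open>q'\<close>, \<open>qb\<close> to avoid
        \<open>q0\<close>; by \<open>common\<close>, every such triangle not ending in
        \<open>e\<close> starts at \<open>z0\<close>.\<close>
      obtain g h where gh: "{g, h} \<inter> {z, p1, q1} \<noteq> {}" if "out b z p1 q1" "\<And>x y. D b x y \<Longrightarrow> z \<noteq> x \<and> z \<noteq> y" for z p1 q1
      proof (cases "\<exists>z p1 q1. out b z p1 q1 \<and> (\<forall>x y. D b x y \<longrightarrow> z \<noteq> x \<and> z \<noteq> y) \<and> p1 \<notin> {p, pa}")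
        case False
        have "{p, pa} \<inter> {z, p1, q1} \<noteq> {}"
          if "out b z p1 q1" "\<And>x y. D b x y \<Longrightarrow> z \<noteq> x \<and> z \<noteq> y" for z p1 q1
        proof -
          have "p1 \<in> {p, pa}" using False that by fast
          then show ?thesis by auto
        qed
        then show ?thesis by (rule that)
      next
        case True
        then obtain z0 p0 q0 where 0: "out b z0 p0 q0" "\<And>x y. D b x y \<Longrightarrow> z0 \<noteq> x \<and> z0 \<noteq> y" "p0 \<notin> {p, pa}" by blast
        obtain e where e: "e \<in> {q', qb}" "q0 \<noteq> e" using B(2) by blast
        show ?thesis
        proof (rule that[of z0 e])
          fix z p1 q1 assume "out b z p1 q1" "\<And>x y. D b x y \<Longrightarrow> z \<noteq> x \<and> z \<noteq> y"
          from common[OF 0(1,2) this 0(3) e(2) _ e(1)] have "q1 \<noteq> e \<Longrightarrow> z0 = z" .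
          then show "{z0, e} \<inter> {z, p1, q1} \<noteq> {}" by auto
        qed
      qed
      have "({x, y'} \<union> set [g, h]) \<inter> {z, p1, q1} \<noteq> {}"
        if "out b z p1 q1" "\<And>x y. D b x y \<Longrightarrow> z \<noteq> x \<and> z \<noteq> y" for z p1 q1
        using gh[OF that] by auto
      moreover have "{x, y'} \<inter> {u, r, s} \<noteq> {}" if "D b u v" "out b u r s" for u v r s using allX[OF that] by simp
      moreover have "{x, y'} \<inter> {v, r, s} \<noteq> {}" if "D b u v" "out b v r s" for u v r s using allY[OF that] by simp
      ultimately show ?thesis by (intro hit_cases[OF X(1), of "[g, h]" x y']) simp_all
    qed
  qed
qed

section \<open>Vertices in at most two triangles\<close>

text \<open>In the applications, \<open>W\<close> carries a grid with rows \<open>R1 \<ni> b\<close>, \<open>R2 \<ni> x\<close>, \<open>R3 \<ni> y\<close>, every triangle at a vertex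
  of \<open>W\<close> lies in \<open>W\<close>, and a vertex outside \<open>W\<close> joins the row preceding the one it attaches to.\<close>

lemma row_coloring:
  assumes T: "D b x y" and W: "W = R1 \<union> R2 \<union> R3" "x \<in> W" "y \<in> W" "b \<in> W"
    and stable: "\<And>u v. u \<in> R1 \<Longrightarrow> v \<in> R1 \<Longrightarrow> \<not> E u v" "\<And>u v. u \<in> R2 \<Longrightarrow> v \<in> R2 \<Longrightarrow> \<not> E u v"
      "\<And>u v. u \<in> R3 \<Longrightarrow> v \<in> R3 \<Longrightarrow> \<not> E u v"
    and closed: "\<And>t u v. t \<in> W \<Longrightarrow> v \<notin> W \<Longrightarrow> E t u \<Longrightarrow> E t v \<Longrightarrow> \<not> E u v"
    and nbrs: "\<And>v r. v \<notin> W \<Longrightarrow> E v x \<Longrightarrow> r \<in> R1 \<Longrightarrow> \<not> E v r"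
      "\<And>v r. v \<notin> W \<Longrightarrow> E v y \<Longrightarrow> r \<in> R2 \<Longrightarrow> \<not> E v r"
      "\<And>v r. v \<notin> W \<Longrightarrow> E v b \<Longrightarrow> r \<in> R3 \<Longrightarrow> \<not> E v r"
  shows "colorable3 V E"
proof -
  have stab: "\<not> E u v"
    if "\<And>u v. u \<in> R \<Longrightarrow> v \<in> R \<Longrightarrow> \<not> E u v" "\<And>v r. v \<notin> W \<Longrightarrow> E v t \<Longrightarrow> r \<in> R \<Longrightarrow> \<not> E v r" "t \<in> W"
      and uv: "u \<in> R \<union> {v. v \<notin> W \<and> E v t}" "v \<in> R \<union> {v. v \<notin> W \<and> E v t}"
    for R t u v
    using that(1)[of u v] that(2)[of u v] that(2)[of v u] closed[OF that(3), of v u] uv E_sym[of u t] E_sym[of v t] E_sym[of u v]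
    by blast
  show ?thesis
  proof (rule colorable3I)
    show "V \<subseteq> (R1 \<union> {v. v \<notin> W \<and> E v x}) \<union> (R2 \<union> {v. v \<notin> W \<and> E v y}) \<union> (R3 \<union> {v. v \<notin> W \<and> E v b})"
      using prism_ex[OF T] W by blast
    show "\<not> E u v" if "u \<in> R1 \<union> {v. v \<notin> W \<and> E v x}" "v \<in> R1 \<union> {v. v \<notin> W \<and> E v x}" for u v
      by (rule stab[OF stable(1) nbrs(1) W(2) that])
    show "\<not> E u v" if "u \<in> R2 \<union> {v. v \<notin> W \<and> E v y}" "v \<in> R2 \<union> {v. v \<notin> W \<and> E v y}" for u v
      by (rule stab[OF stable(2) nbrs(2) W(3) that])
    show "\<not> E u v" if "u \<in> R3 \<union> {v. v \<notin> W \<and> E v b}" "v \<in> R3 \<union> {v. v \<notin> W \<and> E v b}" for u v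
      by (rule stab[OF stable(3) nbrs(3) W(4) that])
  qed
qed

text \<open>Serves the hypothesis \<open>closed\<close> of \<open>row_coloring\<close>: a vertex
  \<open>t\<close> already in two triangles has no third, so the triangle on \<open>t\<close>,
  \<open>u\<close>, \<open>v\<close> is one of the two.\<close>

lemma third_triangle:
  assumes two: "at_most_two D"
    and "D t a c" "D t a' c'" "a \<noteq> a'" "E t u" "E t v" "E u v"
  shows "v \<in> {a, c, a', c'}"
proof -
  have "D t v u \<or> D t u v" using tri[OF assms(5,7,6)] by blast
  then show ?thesis
  proof
    assume "D t v u"
    then show ?thesis using at_most_twoD[OF two assms(2,3)] assms(4) by blast
  next
    assume d: "D t u v"
    then have "u = a \<or> u = a'" using at_most_twoD[OF two assms(2,3)] assms(4) by blast
    then show ?thesis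
      using common_nbr[of t u v] D_edges[OF d] D_edges[OF assms(2)] D_edges[OF assms(3)] by blast
  qed
qed

text \<open>One of the at most two triangles at \<open>x\<close> is already taken by
  \<open>b x y\<close>.\<close>

lemma out_X_unique:
  assumes two: "at_most_two D"
    and "D b x y" "out b x p q" "out b x r s"
  shows "p = r \<and> q = s"
proof -
  note D = outD(1)[OF assms(3)] outD(1)[OF assms(4)]
  have "p = r"
    using at_most_twoD[OF two D_rot[OF assms(2)] D] out_X_type(6)[OF assms(3,2)] out_X_type(6)[OF assms(4,2)] by blast
  then show ?thesis using common_nbr[of x p q s] D_edges[OF D(1)] D_edges[OF D(2)] by blast
qed

lemma out_Y_unique:
  assumes two: "at_most_two D"
    and "D b x y" "out b y p q" "out b y r s"
  shows "p = r \<and> q = s"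
proof -
  note D = outD(1)[OF assms(3)] outD(1)[OF assms(4)]
  have "p = r"
    using at_most_twoD[OF two D_rot[OF D_rot[OF assms(2)]] D] outD(4)[OF assms(3)] outD(4)[OF assms(4)] by blast
  then show ?thesis using common_nbr[of y p q s] D_edges[OF D(1)] D_edges[OF D(2)] by blast
qed

lemma out_X_common:
  assumes two: "at_most_two D"
    and "D b x y" "out b x p q" "D b u v" "out b u r s"
  shows "p = r"
proof (cases "x = u")
  case True
  then show ?thesis using out_X_unique[OF two assms(2,3)] assms(5) by blast
next
  case False
  then show ?thesis using out_at_X[OF assms(3,5,2,4)] by blast
qed

lemma out_Y_common:
  assumes two: "at_most_two D"
    and "D b x y" "out b y p q" "D b u v" "out b v r s"
  shows "q = s"
proof (cases "y = v")
  case True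
  then show ?thesis using out_Y_unique[OF two assms(2,3)] assms(5) by blast
next
  case False
  then show ?thesis using out_at_Y[OF assms(3,5,2,4)] by blast
qed

lemma two_sided_disjoint:
  assumes two: "at_most_two D"
    and ix: "D b x y" "D b x' y'" "x \<noteq> x'"
    and oX: "out b x p q" and oY: "out b y' p' q'" and qp: "q \<noteq> p'"
  shows "hit5 D"
proof (rule hit_two_sided[OF ix oX oY qp, of p q'])
  show "{p, q'} \<inter> {u, r, s} \<noteq> {}" if "D b u v" "out b u r s" for u v r s
    using out_X_common[OF two ix(1) oX that] by simp
  show "{p, q'} \<inter> {v, r, s} \<noteq> {}" if "D b u v" "out b v r s" for u v r s
    using out_Y_common[OF two ix(2) oY that] by simp
qed simp

text \<open>Here \<open>y' \<rightarrow> q \<rightarrow> q'\<close> and \<open>x' \<rightarrow> p \<rightarrow> p'\<close> are triangles as well, completing an \<open>L(K\<^sub>3\<^sub>,\<^sub>3)\<close> whose rows are \<open>R1\<close>,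
  \<open>R2\<close>, \<open>R3\<close>. A vertex attached to a column would have no neighbour in a triangle \<open>z \<rightarrow> p0 \<rightarrow> q0\<close> attached to
  the rows.\<close>

lemma two_sided_same_index:
  assumes two: "at_most_two D"
    and ix: "D b x y" "D b x' y'" "x \<noteq> x'"
    and oX: "out b x p q" and oY: "out b y p' q'"
  shows "colorable3 V E \<or> hit5 D"
proof -
  note i = index_uniq[OF ix(1,2)]
  have yy: "y \<noteq> x'" "y \<noteq> y'" "x \<noteq> y'" using i ix(3) by blast+
  note sX = out_X_type[OF oX ix(1)] out_type[OF oX ix(2,3) yy(3)]
  note sY = out_Y_type[OF oY ix(1)] out_type[OF oY ix(2) yy(1,2)]
  note DX = outD(1)[OF oX] and DY = outD(1)[OF oY]
  note pp = out_at_index[OF ix(1) oX oY]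
  \<comment> \<open>\<open>q\<close> and \<open>q'\<close> are matched by
    \<open>out_at_index\<close> and both see \<open>y'\<close>. In the other orientation
    \<open>q\<close> would come last and be adjacent to \<open>y\<close>, which it is not;
    \<open>X2\<close> is analogous.\<close>
  have Y2: "out b y' q q'"
    using out_triangle[of b y' q q'] out_type(2)[of b y' q' q x y] sX sY pp outD[OF oX] outD[OF oY]
      D_edges(3)[OF ix(2)] E_sym ix(1) yy by metis
  have X2: "out b x' p p'"
    using out_triangle[of b x' p p'] out_type(1)[of b x' p' p x y] sX sY pp outD[OF oX] outD[OF oY]
      D_edges(1)[OF ix(2)] E_sym ix yy by metis
  note DY2 = outD(1)[OF Y2] and DX2 = outD(1)[OF X2]
  have allX: "{p, q'} \<inter> {u, r, s} \<noteq> {}" if "D b u v" "out b u r s" for u v r s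
    using out_X_common[OF two ix(1) oX that] by simp
  have allY: "{p, q'} \<inter> {v, r, s} \<noteq> {}" if "D b u v" "out b v r s" for u v r s
    using out_Y_common[OF two ix(1) oY that] by simp
  show ?thesis
  proof (cases "\<exists>z p q. out b z p q \<and> (\<forall>x y. D b x y \<longrightarrow> z \<noteq> x \<and> z \<noteq> y)")
    case False
    have "hit5 D" by (rule hit_cases[OF ix(1) _ allX allY, of "[]"]) (use False in fastforce)+
    then show ?thesis ..
  next
    case True
    then obtain z p0 q0 where oz: "out b z p0 q0" and z: "\<And>x y. D b x y \<Longrightarrow> z \<noteq> x \<and> z \<noteq> y" by blast
    note Dz = outD(1)[OF oz]
    have zx: "z \<noteq> x" "z \<noteq> y" "z \<noteq> x'" "z \<noteq> y'" using z ix by blast+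
    note sz = out_type[OF oz ix(1) zx(1,2)] out_type[OF oz ix(2) zx(3,4)]
    \<comment> \<open>\<open>p\<close> and, further below, \<open>q'\<close> each lie in two
      triangles of the configuration already, so \<open>z p0 q0\<close> avoids them and
      \<open>Z_adj\<close> and \<open>Z_adj'\<close> apply.\<close>
    have "p0 \<noteq> p"
    proof
      assume "p0 = p"
      then have "q = p' \<or> q = q0 \<or> p' = q0"
        using at_most_twoD[OF two D_rot[OF DX] D_rot[OF DX2] D_rot[OF Dz, unfolded \<open>p0 = p\<close>]] by blast
      then show False using sX sY sz by blast
    qed
    then have zq: "E z q" "E p q0" using Z_adj[OF ix oX oz z] by blast+
    have "q0 \<noteq> q'"
    proof
      assume "q0 = q'"
      then have "y = y' \<or> y = z \<or> y' = z"
        using at_most_twoD[OF two D_rot[OF D_rot[OF DY]] D_rot[OF D_rot[OF DY2]] D_rot[OF D_rot[OF Dz], unfolded \<open>q0 = q'\<close>]]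
        by blast
      then show False using yy zx by blast
    qed
    then have zp: "E z p'" "E q' p0" using Z_adj'[OF ix(1,2) yy(2) oY oz z] by blast+
    define R1 R2 R3 W where R: "R1 = {b, q, p'}" "R2 = {x, x', q'}" "R3 = {y, y', p}" and W: "W = R1 \<union> R2 \<union> R3"
    note third = third_triangle[OF two]
    have closed: "\<not> E u v" if t: "t \<in> W" "v \<notin> W" "E t u" "E t v" for t u v
    proof
      assume uv: "E u v"
      note f = third[OF _ _ _ t(3,4) uv]
      have v: "v \<notin> {b, q, p', x, x', q', y, y', p}" using t(2) unfolding W R by blast
      from t(1) consider "t = b" | "t = q" | "t = p'" | "t = x" | "t = x'" | "t = q'" | "t = y" | "t = y'" | "t = p"
        unfolding W R by blast
      then show False
      proof cases
        case 1 then show False using f[of x y x' y'] ix v by blast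
      next
        case 2 then show False using f[of x p q' y'] D_rot[OF D_rot[OF DX]] D_rot[OF DY2] sY v by blast
      next
        case 3 then show False using f[of q' y x' p] DY DX2 D_rot sY v by blast
      next
        case 4 then show False using f[of p q y b] DX D_rot[OF ix(1)] sX v by blast
      next
        case 5 then show False using f[of p p' y' b] DX2 D_rot[OF ix(2)] sX v by blast
      next
        case 6 then show False using f[of y p' y' q] D_rot[OF D_rot[OF DY]] D_rot[OF D_rot[OF DY2]] yy v by blast
      next
        case 7 then show False using f[of p' q' b x] DY D_rot[OF D_rot[OF ix(1)]] outD[OF oY] v by blast
      next
        case 8 then show False using f[of q q' b x'] DY2 D_rot[OF D_rot[OF ix(2)]] outD[OF Y2] v by blast
      next
        case 9 then show False using f[of q x p' x'] D_rot[OF DX] D_rot[OF DX2] sX sY v by blast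
      qed
    qed
    have inW: "b \<in> W" "q \<in> W" "p' \<in> W" "x \<in> W" "x' \<in> W" "q' \<in> W" "y \<in> W" "y' \<in> W" "p \<in> W"
      unfolding W R by blast+
    have cl: "\<not> E v t \<or> \<not> E v u" if "v \<notin> W" "t \<in> W" "E u t" for t u v
      using closed[OF that(2,1), of u] that(3) E_sym by blast
    have one: "(E v a \<or> E v c \<or> E v d) \<and> \<not> (E v a \<and> E v c) \<and> \<not> (E v c \<and> E v d) \<and> \<not> (E v a \<and> E v d)"
      if "D a c d" "v \<notin> {a, c, d}" "v \<in> V" for v a c d
      using prism_ex[OF that(1,3,2)] nbr_D[OF that(1), of v] nbr_D[OF D_rot[OF that(1)], of v] that(2) by blast
    have rows: "\<not> (E v x \<and> E v p')" "\<not> (E v y \<and> E v x')" "\<not> (E v b \<and> E v p)"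
      "\<not> (E v x \<and> E v b)" "\<not> (E v x \<and> E v q)" "\<not> (E v y \<and> E v x)" "\<not> (E v y \<and> E v q')"
      "\<not> (E v b \<and> E v y)" "\<not> (E v b \<and> E v y')" if v: "v \<in> V" "v \<notin> W" for v
    proof -
      have vn: "v \<notin> {b, q, p', x, x', q', y, y', p}" using v(2) unfolding W R by blast
      note o = one[OF ix(1) _ v(1)] one[OF ix(2) _ v(1)] one[OF DX _ v(1)] one[OF DY _ v(1)]
        one[OF DX2 _ v(1)] one[OF DY2 _ v(1)]
      have o': "(E v b \<or> E v x \<or> E v y) \<and> \<not> (E v b \<and> E v x) \<and> \<not> (E v x \<and> E v y) \<and> \<not> (E v b \<and> E v y)"
        "(E v b \<or> E v x' \<or> E v y') \<and> \<not> (E v b \<and> E v x') \<and> \<not> (E v x' \<and> E v y') \<and> \<not> (E v b \<and> E v y')"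
        "(E v x \<or> E v p \<or> E v q) \<and> \<not> (E v x \<and> E v p) \<and> \<not> (E v p \<and> E v q) \<and> \<not> (E v x \<and> E v q)"
        "(E v y \<or> E v p' \<or> E v q') \<and> \<not> (E v y \<and> E v p') \<and> \<not> (E v p' \<and> E v q') \<and> \<not> (E v y \<and> E v q')"
        "(E v x' \<or> E v p \<or> E v p') \<and> \<not> (E v x' \<and> E v p) \<and> \<not> (E v p \<and> E v p') \<and> \<not> (E v x' \<and> E v p')"
        "(E v y' \<or> E v q \<or> E v q') \<and> \<not> (E v y' \<and> E v q) \<and> \<not> (E v q \<and> E v q') \<and> \<not> (E v y' \<and> E v q')"
        using o vn by simp_all
      have zz: "v = z \<or> v = p0 \<or> v = q0 \<or> E v z \<or> E v p0 \<or> E v q0"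
        using prism_ex[OF Dz v(1)] by blast
      have c: "E v z \<Longrightarrow> \<not> E v b \<and> \<not> E v q \<and> \<not> E v p'"
        "E v p0 \<Longrightarrow> \<not> E v x \<and> \<not> E v x' \<and> \<not> E v q'"
        "E v q0 \<Longrightarrow> \<not> E v y \<and> \<not> E v y' \<and> \<not> E v p"
        using cl[OF v(2) inW(1) outD(3)[OF oz]] cl[OF v(2) inW(2) zq(1)] cl[OF v(2) inW(3) zp(1)]
          cl[OF v(2) inW(4) sz(1)] cl[OF v(2) inW(5) sz(11)] cl[OF v(2) inW(6) E_sym[OF zp(2)]]
          cl[OF v(2) inW(7) sz(2)] cl[OF v(2) inW(8) sz(12)] cl[OF v(2) inW(9) E_sym[OF zq(2)]]
        by blast+
      have c': "v = z \<Longrightarrow> E v b \<and> E v q \<and> E v p'" "v = p0 \<Longrightarrow> E v x \<and> E v x' \<and> E v q'"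
        "v = q0 \<Longrightarrow> E v y \<and> E v y' \<and> E v p"
        using outD(3)[OF oz] zq zp sz E_sym by blast+
      \<comment> \<open>Having exactly one neighbour in each of the six triangles, a
        \<open>v\<close> adjacent to one of these pairs would have a neighbour in every row. But
        \<open>z\<close>, \<open>p0\<close>, \<open>q0\<close> are complete to \<open>R1\<close>,
        \<open>R2\<close>, \<open>R3\<close>, so by \<open>closed\<close> a neighbour of one of them
        misses a whole row.\<close>
      show "\<not> (E v x \<and> E v p')" "\<not> (E v y \<and> E v x')" "\<not> (E v b \<and> E v p)"
        using zz o' c c' by argo+
      show "\<not> (E v x \<and> E v b)" "\<not> (E v x \<and> E v q)" "\<not> (E v y \<and> E v x)" "\<not> (E v y \<and> E v q')"
        "\<not> (E v b \<and> E v y)" "\<not> (E v b \<and> E v y')" using o' by argo+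
    qed
    have "\<not> E q p'" 
      using prism_uniq[OF D_rot[OF DX], of p'] E_sym[OF pp(1)] E_sym[of q p'] sY by blast
    have "colorable3 V E"
    proof (rule row_coloring[OF ix(1) W inW(4,7,1)])
      show "\<not> E u v" if "u \<in> R1" "v \<in> R1" for u v

      proof -
        have "\<not> E b q" "\<not> E b p'" using outD[OF oX] outD[OF oY] by blast+
        then show ?thesis using that \<open>\<not> E q p'\<close> E_sym E_irrefl unfolding R by auto
      qed
      show "\<not> E u v" if "u \<in> R2" "v \<in> R2" for u v

      proof -
        have "\<not> E x x'" "\<not> E q' x" "\<not> E q' x'" using nbr_index_nonadj(1)[OF ix] sY by blast+
        then show ?thesis using that E_sym E_irrefl unfolding R by auto
      qed
      show "\<not> E u v" if "u \<in> R3" "v \<in> R3" for u v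

      proof -
        have "\<not> E y y'" "\<not> E p y" "\<not> E p y'" using nbr_index_nonadj(4)[OF ix] sX by blast+
        then show ?thesis using that E_sym E_irrefl unfolding R by auto
      qed
      show "\<not> E v r" if "v \<notin> W" "E v x" "r \<in> R1" for v r
        using rows(1,4,5)[OF E_V[OF that(2)] that(1)] that(2,3) unfolding R by blast
      show "\<not> E v r" if "v \<notin> W" "E v y" "r \<in> R2" for v r
        using rows(2,6,7)[OF E_V[OF that(2)] that(1)] that(2,3) unfolding R by blast
      show "\<not> E v r" if "v \<notin> W" "E v b" "r \<in> R3" for v r
        using rows(3,8,9)[OF E_V[OF that(2)] that(1)] that(2,3) unfolding R by blast
    qed (rule closed)
    then show ?thesis ..
  qed
qed

text \<open>The triangles \<open>bxy\<close>, \<open>xpw\<close>, \<open>y'wq'\<close>, \<open>bx'y'\<close> form an \<open>L(K\<^sub>3\<^sub>,\<^sub>3)\<close> lacking the third vertex of the row of \<open>b\<close>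
  and \<open>w\<close>.\<close>

lemma two_sided_four_cycle:
  assumes two: "at_most_two D"
    and ix: "D b x y" "D b x' y'" "x \<noteq> x'"
    and oX: "out b x p w" and oY: "out b y' w q'"
    and noX: "\<And>r s. \<not> out b x' r s" and noY: "\<And>r s. \<not> out b y r s"
  shows "colorable3 V E \<or> hit5 D"
proof -
  note i = index_uniq[OF ix(1,2)]
  have yy: "y \<noteq> x'" "y' \<noteq> y" "y' \<noteq> x" "y \<noteq> y'" "x \<noteq> y'" using i ix(3) by blast+
  note sX = out_X_type[OF oX ix(1)] out_type[OF oX ix(2,3) yy(5)]
  note sY = out_Y_type[OF oY ix(2)] out_type[OF oY ix(1) yy(3,2)]
  note DX = outD(1)[OF oX] and DY = outD(1)[OF oY]
  have two_b: "u = x \<and> v = y \<or> u = x' \<and> v = y'" if "D b u v" for u v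
    using at_most_twoD[OF two ix(1,2) that] ix(3) index_uniq(1)[OF ix(1) that] index_uniq(1)[OF ix(2) that] by blast
  have at_X: "u = x \<and> r = p \<and> s = w" if "D b u v" "out b u r s" for u v r s
    using two_b[OF that(1)] noX that(2) out_X_unique[OF two ix(1) oX] by blast
  have at_Y: "v = y' \<and> r = w \<and> s = q'" if "D b u v" "out b v r s" for u v r s
    using two_b[OF that(1)] noY that(2) out_Y_unique[OF two ix(2) oY] by blast
  show ?thesis
  proof (cases "\<exists>z p q. out b z p q \<and> (\<forall>x y. D b x y \<longrightarrow> z \<noteq> x \<and> z \<noteq> y)")
    case False
    have allX: "{w, w} \<inter> {u, r, s} \<noteq> {}" if "D b u v" "out b u r s" for u v r s
      using at_X[OF that] by simp
    have allY: "{w, w} \<inter> {v, r, s} \<noteq> {}" if "D b u v" "out b v r s" for u v r s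
      using at_Y[OF that] by simp
    have "hit5 D" by (rule hit_cases[OF ix(1) _ allX allY, of "[]"]) (use False in fastforce)+
    then show ?thesis ..
  next
    case True
    then obtain z p0 q0 where oz: "out b z p0 q0" and z: "\<And>x y. D b x y \<Longrightarrow> z \<noteq> x \<and> z \<noteq> y" by blast
    have Z: "c \<noteq> p" "c \<noteq> q'" "d \<noteq> p" "d \<noteq> q'" "e \<noteq> p" "e \<noteq> q'" "E c w" "E p e" "E q' d"
      if oc: "out b c d e" and c: "\<And>x y. D b x y \<Longrightarrow> c \<noteq> x \<and> c \<noteq> y" for c d e
    proof -
      have cx: "c \<noteq> x" "c \<noteq> y" "c \<noteq> x'" "c \<noteq> y'" using c ix by blast+
      note sc = out_type[OF oc ix(1) cx(1,2)] out_type[OF oc ix(2) cx(3,4)]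
      note Dc = outD(1)[OF oc]
      show "c \<noteq> p" "c \<noteq> q'" using outD(2)[OF oc] outD(6,7)[OF oX] outD(6,7)[OF oY] by blast+
      show "d \<noteq> q'" "e \<noteq> p" using sc sX sY by blast+
      \<comment> \<open>If \<open>d = p\<close>, the mirror lemma makes \<open>w\<close> adjacent to
        \<open>c\<close>; being adjacent to \<open>p\<close> as well, \<open>w\<close> would be
        \<open>e\<close>, but \<open>w\<close> sees \<open>x\<close> and \<open>e\<close> does
        not.\<close>
      show dp: "d \<noteq> p"
      proof
        assume "d = p"
        have "e \<noteq> q'"
        proof
          assume "e = q'"
          then have "E p q'" "E p w" using D_edges[OF Dc] D_edges[OF DX] \<open>d = p\<close> by blast+
          then show False using prism_uniq[OF D_rot[OF DY], of p] sX by blast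
        qed
        then have "E c w" using Z_adj'[OF ix(2,1) yy(2) oY oc c] by blast
        then have "w = e"
          using prism_uniq[OF Dc, of w] D_edges[OF DX] \<open>d = p\<close> E_sym by blast
        then show False using sX sc by blast
      qed
      have zw: "E c w" "E p e" using Z_adj[OF ix oX oc c dp] by blast+
      then show "E c w" "E p e" by blast+
      show eq: "e \<noteq> q'"
      proof
        assume "e = q'"
        then have "w = d"
          using prism_uniq[OF D_rot[OF D_rot[OF Dc]], of w] D_edges[OF DY] E_sym[OF zw(1)] by blast
        then show False using sX sc by blast
      qed
      show "E q' d" using Z_adj'[OF ix(2,1) yy(2) oY oc c eq] by blast
    qed
    have zx: "z \<noteq> x" "z \<noteq> y" "z \<noteq> x'" "z \<noteq> y'" using z ix by blast+
    note sz = out_type[OF oz ix(1) zx(1,2)] out_type[OF oz ix(2) zx(3,4)]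
    have zf: "E z w" "E p q0" "E q' p0" using Z[OF oz z] by blast+
    note Dz = outD(1)[OF oz]
    define R1 R2 R3 W where R: "R1 = {b, w}" "R2 = {x, x', q'}" "R3 = {y, y', p}" and W: "W = R1 \<union> R2 \<union> R3"
    have inW: "b \<in> W" "w \<in> W" "x \<in> W" "x' \<in> W" "q' \<in> W" "y \<in> W" "y' \<in> W" "p \<in> W"
      unfolding W R by blast+
    have cls: "(c = x \<and> d = p \<and> e = w) \<or> (c = y' \<and> d = w \<and> e = q') \<or> {p, q'} \<inter> {c, d, e} = {}"
      if oc: "out b c d e" for c d e
    proof (cases "\<forall>x y. D b x y \<longrightarrow> c \<noteq> x \<and> c \<noteq> y")
      case True
      then have "\<And>x y. D b x y \<Longrightarrow> c \<noteq> x \<and> c \<noteq> y" by blast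
      from Z(1-6)[OF oc this] show ?thesis by simp
    next
      case False
      then show ?thesis using at_X[OF _ oc] at_Y[OF _ oc] by blast
    qed
    \<comment> \<open>Only \<open>b\<close>, \<open>w\<close>, \<open>x\<close>, \<open>y'\<close>
      lie in two triangles inside \<open>W\<close>. For the other four vertices closedness cannot
      come from \<open>third_triangle\<close>; instead \<open>cls\<close>, \<open>noX\<close> and
      \<open>noY\<close> place all their triangles inside \<open>W\<close>.\<close>
    have key: "u \<in> W \<and> v \<in> W" if d: "D t u v" "t \<in> {p, q', x', y}" for t u v
    proof (cases "t \<in> {p, q'}")
      case True
      have "b \<notin> {t, u, v}" using True outD[OF oX] outD[OF oY] D_edges[OF d(1)] by blast
      then have "out b t u v \<or> out b u v t \<or> out b v t u" using out_cases[OF d(1)] outD(11)[OF oX] by blast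
      then show ?thesis using cls[of t u v] cls[of u v t] cls[of v t u] True inW by blast
    next
      case False
      then have t: "t = x' \<or> t = y" using d(2) by blast
      then have bt: "E b t" using D_edges[OF ix(1)] D_edges[OF ix(2)] by blast
      show ?thesis
      proof (cases "b \<in> {u, v}")
        case True
        then have "u = b \<and> D b v t \<or> v = b \<and> D b t u" using D_rot[OF d(1)] D_rot[OF D_rot[OF d(1)]] by blast
        then show ?thesis using two_b[of v t] two_b[of t u] inW by blast
      next
        case False
        then have "out b t u v" using d(1) bt unfolding outer_def by blast
        then show ?thesis using t noX noY by blast
      qed
    qed
    have closed: "\<not> E u v" if t: "t \<in> W" "v \<notin> W" "E t u" "E t v" for t u v
    proof
      assume uv: "E u v"
      note f = third_triangle[OF two _ _ _ t(3,4) uv]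
      have v: "v \<notin> {b, w, x, x', q', y, y', p}" using t(2) unfolding W R by blast
      from t(1) consider "t = b" | "t = w" | "t = x" | "t = y'" | "t \<in> {p, q', x', y}"
        unfolding W R by blast
      then show False
      proof cases
        case 1 then show False using f[of x y x' y'] ix v by blast
      next
        case 2 then show False using f[of x p q' y'] D_rot[OF D_rot[OF DX]] D_rot[OF DY] sY v by blast
      next
        case 3 then show False using f[of p w y b] DX D_rot[OF ix(1)] sX v by blast
      next
        case 4 then show False using f[of w q' b x'] DY D_rot[OF D_rot[OF ix(2)]] outD[OF oY] v by blast
      next
        case 5 then show False using key[of t u v] key[of t v u] tri[OF t(3) uv t(4)] t(2) by blast
      qed
    qed
    have cl: "\<not> E v t \<or> \<not> E v u" if "v \<notin> W" "t \<in> W" "E u t" for t u v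
      using closed[OF that(2,1), of u] that(3) E_sym by blast
    have one: "(E v a \<or> E v c \<or> E v d) \<and> \<not> (E v a \<and> E v c) \<and> \<not> (E v c \<and> E v d) \<and> \<not> (E v a \<and> E v d)"
      if "D a c d" "v \<notin> {a, c, d}" "v \<in> V" for v a c d
      using prism_ex[OF that(1,3,2)] nbr_D[OF that(1), of v] nbr_D[OF D_rot[OF that(1)], of v] that(2) by blast
    have rows: "\<not> (E v y \<and> E v x')" "\<not> (E v b \<and> E v p)" "\<not> (E v y \<and> E v q')"
      "\<not> (E v x \<and> E v b)" "\<not> (E v x \<and> E v w)" "\<not> (E v y \<and> E v x)" 
      "\<not> (E v b \<and> E v y)" "\<not> (E v b \<and> E v y')" if v: "v \<in> V" "v \<notin> W" for v
    proof -
      have vn: "v \<notin> {b, w, x, x', q', y, y', p}" using v(2) unfolding W R by blast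
      note o = one[OF ix(1) _ v(1)] one[OF ix(2) _ v(1)] one[OF DX _ v(1)] one[OF DY _ v(1)]
      have o': "(E v b \<or> E v x \<or> E v y) \<and> \<not> (E v b \<and> E v x) \<and> \<not> (E v x \<and> E v y) \<and> \<not> (E v b \<and> E v y)"
        "(E v b \<or> E v x' \<or> E v y') \<and> \<not> (E v b \<and> E v x') \<and> \<not> (E v x' \<and> E v y') \<and> \<not> (E v b \<and> E v y')"
        "(E v x \<or> E v p \<or> E v w) \<and> \<not> (E v x \<and> E v p) \<and> \<not> (E v p \<and> E v w) \<and> \<not> (E v x \<and> E v w)"
        "(E v y' \<or> E v w \<or> E v q') \<and> \<not> (E v y' \<and> E v w) \<and> \<not> (E v w \<and> E v q') \<and> \<not> (E v y' \<and> E v q')"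
        using o vn by simp_all
      have zz: "v = z \<or> v = p0 \<or> v = q0 \<or> E v z \<or> E v p0 \<or> E v q0"
        using prism_ex[OF Dz v(1)] by blast
      \<comment> \<open>The last two parts replace the triangles through the missing vertex:
        \<open>x' p\<close> and \<open>y q'\<close> are edges, so by \<open>closed\<close> no
        \<open>v\<close> outside \<open>W\<close> sees both ends.\<close>
      have c: "E v z \<Longrightarrow> \<not> E v b \<and> \<not> E v w"
        "E v p0 \<Longrightarrow> \<not> E v x \<and> \<not> E v x' \<and> \<not> E v q'"
        "E v q0 \<Longrightarrow> \<not> E v y \<and> \<not> E v y' \<and> \<not> E v p"
        "\<not> (E v x' \<and> E v p)" "\<not> (E v y \<and> E v q')"
        using cl[OF v(2) inW(1) outD(3)[OF oz]] cl[OF v(2) inW(2) zf(1)]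
          cl[OF v(2) inW(3) sz(1)] cl[OF v(2) inW(4) sz(11)] cl[OF v(2) inW(5) E_sym[OF zf(3)]]
          cl[OF v(2) inW(6) sz(2)] cl[OF v(2) inW(7) sz(12)] cl[OF v(2) inW(8) E_sym[OF zf(2)]]
          cl[OF v(2) inW(4) sX(9)] cl[OF v(2) inW(6) sY(10)]
        by blast+
      have c': "v = z \<Longrightarrow> E v b \<and> E v w" "v = p0 \<Longrightarrow> E v x \<and> E v x' \<and> E v q'"
        "v = q0 \<Longrightarrow> E v y \<and> E v y' \<and> E v p"
        using outD(3)[OF oz] zf sz E_sym by blast+
      show "\<not> (E v y \<and> E v x')" "\<not> (E v b \<and> E v p)"
        using zz o' c c' by argo+
      show "\<not> (E v y \<and> E v q')" "\<not> (E v x \<and> E v b)" "\<not> (E v x \<and> E v w)" "\<not> (E v y \<and> E v x)"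
        "\<not> (E v b \<and> E v y)" "\<not> (E v b \<and> E v y')" using o' c by argo+
    qed
    have "colorable3 V E"
    proof (rule row_coloring[OF ix(1) W inW(3,6,1)])
      show "\<not> E u v" if "u \<in> R1" "v \<in> R1" for u v
        using that outD(7)[OF oX] E_sym E_irrefl unfolding R by auto
      show "\<not> E u v" if "u \<in> R2" "v \<in> R2" for u v
      proof -
        have "\<not> E x x'" "\<not> E q' x" "\<not> E q' x'" using nbr_index_nonadj(1)[OF ix] sY by blast+
        then show ?thesis using that E_sym E_irrefl unfolding R by auto
      qed
      show "\<not> E u v" if "u \<in> R3" "v \<in> R3" for u v
      proof -
        have "\<not> E y y'" "\<not> E p y" "\<not> E p y'" using nbr_index_nonadj(4)[OF ix] sX by blast+
        then show ?thesis using that E_sym E_irrefl unfolding R by auto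
      qed
      show "\<not> E v r" if "v \<notin> W" "E v x" "r \<in> R1" for v r
        using rows(4,5)[OF E_V[OF that(2)] that(1)] that(2,3) unfolding R by blast
      show "\<not> E v r" if "v \<notin> W" "E v y" "r \<in> R2" for v r
        using rows(1,3,6)[OF E_V[OF that(2)] that(1)] that(2,3) unfolding R by blast
      show "\<not> E v r" if "v \<notin> W" "E v b" "r \<in> R3" for v r
        using rows(2,7,8)[OF E_V[OF that(2)] that(1)] that(2,3) unfolding R by blast
    qed (rule closed)
    then show ?thesis ..
  qed
qed

text \<open>Distinguishes whether the outer triangles sit at the same triangle of \<open>b\<close>,
  and if not, whether \<open>q = p'\<close>. In the latter case, a failure of the extra hypotheses
  of \<open>two_sided_four_cycle\<close> leads back to the same triangle of
  \<open>b\<close>.\<close>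

lemma two_sided_two:
  assumes two: "at_most_two D" and ix: "D b x y" "D b x' y'" "x \<noteq> x'"
    and X: "D b u v" "out b u p q" and Y: "D b u' v'" "out b v' p' q'"
  shows "colorable3 V E \<or> hit5 D"
proof -
  have same: ?thesis if s: "D b s t" "out b s r1 r2" "out b t r3 r4" for s t r1 r2 r3 r4
  proof -
    obtain s' t' where "D b s' t'" "s \<noteq> s'" using ix by metis
    then show ?thesis using two_sided_same_index[OF two s(1) _ _ s(2,3)] by blast
  qed
  show ?thesis
  proof (cases "u = u'")
    case True
    then have "v = v'" using index_uniq[OF X(1) Y(1)] by blast
    then show ?thesis using same[OF X] Y(2) by blast
  next
    case False
    show ?thesis
    proof (cases "q = p'")
      case True
      then show ?thesis
        using two_sided_four_cycle[OF two X(1) Y(1) False X(2), of q'] Y(2) same[OF X] same[OF Y(1) _ Y(2)] by blast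
    next
      case q: False
      show ?thesis using two_sided_disjoint[OF two X(1) Y(1) False X(2) Y(2) q] by blast
    qed
  qed
qed

text \<open>Each class consists of the neighbours outside the triangle of one of its vertices, say
  \<open>a\<close>, together with the predecessor \<open>c\<close> of \<open>a\<close>. An edge
  between two neighbours of \<open>a\<close> would give a second triangle at \<open>a\<close>, and a
  neighbour of \<open>a\<close> that also sees \<open>c\<close> would be \<open>b\<close>.\<close>

lemma colorable_disjoint_triangles:
  assumes T: "D a b c" and uniq: "\<And>v x y x' y'. D v x y \<Longrightarrow> D v x' y' \<Longrightarrow> x = x'"
  shows "colorable3 V E"
proof -
  have stab: "\<not> E u v" if T: "D a b c" and uv: "u \<in> {c} \<union> {v. E v a \<and> v \<noteq> b \<and> v \<noteq> c}" "v \<in> {c} \<union> {v. E v a \<and> v \<noteq> b \<and> v \<noteq> c}"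
    for a b c u v
  proof
    assume E: "E u v"
    show False
    proof (cases "u = c \<or> v = c")
      case True
      then obtain s where "E s c" "E s a" "s \<noteq> b" using E uv E_sym E_irrefl by blast
      then show False using prism_uniq[OF D_rot[OF D_rot[OF T]]] by blast
    next
      case False
      then have "E a u" "E a v" "u \<noteq> b" "v \<noteq> b" using uv E_sym by blast+
      then have "D a u v \<or> D a v u" using tri[of a u v] E by blast
      then show False using uniq[OF T] \<open>u \<noteq> b\<close> \<open>v \<noteq> b\<close> by blast
    qed
  qed
  show ?thesis
  proof (rule colorable3I)
    show "V \<subseteq> ({c} \<union> {v. E v a \<and> v \<noteq> b \<and> v \<noteq> c}) \<union> ({a} \<union> {v. E v b \<and> v \<noteq> c \<and> v \<noteq> a})
      \<union> ({b} \<union> {v. E v c \<and> v \<noteq> a \<and> v \<noteq> b})"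
      using prism_ex[OF T] by blast
  qed (fact stab[OF T] stab[OF D_rot[OF T]] stab[OF D_rot[OF D_rot[OF T]]])+
qed

section \<open>Combination of the cases, by the largest number of triangles at a vertex\<close>

lemma colorable_or_hit: "colorable3 V E \<or> hit5 D"
proof (cases "\<exists>b x y x' y'. D b x y \<and> D b x' y' \<and> x \<noteq> x'")
  case False
  show ?thesis
  proof (cases "\<exists>a b c. D a b c")
    case True
    then obtain a b c where "D a b c" by blast
    moreover have "x = x'" if "D v x y" "D v x' y'" for v x y x' y' using False that by blast
    ultimately show ?thesis using colorable_disjoint_triangles by blast
  next
    case none: False
    then have "hit5 D" unfolding hit5_def by (intro exI[of _ "{}"]) simp
    then show ?thesis ..
  qed
next
  case True
  have one: ?thesis if ix: "D b x y" "D b x' y'" "x \<noteq> x'"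
    and no: "(\<forall>u v p q. D b u v \<longrightarrow> \<not> out b u p q) \<or> (\<forall>u v p q. D b u v \<longrightarrow> \<not> out b v p q)" for b x y x' y'
    using no
  proof
    assume "\<forall>u v p q. D b u v \<longrightarrow> \<not> out b u p q"
    then show ?thesis using one_side[OF ix] by blast
  next
    assume no: "\<forall>u v p q. D b u v \<longrightarrow> \<not> out b v p q"
    have "\<not> outer E (\<lambda>a b c. D a c b) b v p q" if "D b u v" for u v p q
      using no that unfolding outer_def by blast
    moreover have "y \<noteq> y'" using index_uniq[OF ix(1,2)] ix(3) by blast
    ultimately have "colorable3 V E \<or> hit5 (\<lambda>a b c. D a c b)"
      using oriented_prismatic.one_side[OF reverse ix(1,2)] by blast
    then show ?thesis unfolding hit5_reverse[of D] .
  qed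
  show ?thesis
  proof (cases "at_most_two D")
    case two: True
    obtain b x y x' y' where ix: "D b x y" "D b x' y'" "x \<noteq> x'" using True by blast
    show ?thesis
    proof (rule ccontr)
      assume neg: "\<not> ?thesis"
      then obtain u v p q u' v' p' q' where "D b u v" "out b u p q" "D b u' v'" "out b v' p' q'"
        using one[OF ix] by blast
      then show False using two_sided_two[OF two ix] neg by blast
    qed
  next
    case False
    then obtain b x1 y1 x2 y2 x3 y3 where D: "D b x1 y1" "D b x2 y2" "D b x3 y3"
      and ne: "x1 \<noteq> x2" "x1 \<noteq> x3" "x2 \<noteq> x3"
      unfolding at_most_two_def by blast
    have third: "\<exists>x'' y''. D b x'' y'' \<and> x'' \<noteq> x \<and> x'' \<noteq> x'" for x x' using D ne by metis
    show ?thesis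
    proof (rule ccontr)
      assume neg: "\<not> ?thesis"
      then obtain u v p q u' v' p' q' where "D b u v" "out b u p q" "D b u' v'" "out b v' p' q'"
        using one[OF D(1,2) ne(1)] by blast
      then show False using two_sided_three[OF third] neg by blast
    qed
  qed
qed

end

section \<open>Orientations of graphs\<close>

lemma card_three: "card {a, b, c} = 3 \<longleftrightarrow> a \<noteq> b \<and> b \<noteq> c \<and> a \<noteq> c"
  by (auto simp: card_insert_if)

lemma cycle_rotate: "a \<noteq> b \<Longrightarrow> b \<noteq> c \<Longrightarrow> a \<noteq> c \<Longrightarrow> cycle_of_list [b, c, a] = cycle_of_list [a, b, c]"
  using cycle_of_list_rotate_independent[of "[a, b, c]" "Suc 0"] by (simp del: cycle_of_list.simps)

lemma cycle_asym:
  assumes "a \<noteq> b" "b \<noteq> c" "a \<noteq> c"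
  shows "cycle_of_list [a, b, c] \<noteq> cycle_of_list [a, c, b]"
proof
  assume "cycle_of_list [a, b, c] = cycle_of_list [a, c, b]"
  then have "cycle_of_list [a, b, c] a = cycle_of_list [a, c, b] a" by (rule fun_cong)
  with assms show False by simp
qed

text \<open>Turns the isomorphism form of \<open>co_bridge_free\<close> into the pointwise form of
  \<open>no_co_bridge\<close>: the subgraph induced on the six vertices is a copy of
  \<open>co_bridge\<close>.\<close>

lemma co_bridge_freeD:
  assumes G: "pair_graph G" and free: "co_bridge_free G"
    and cyc: "(a, b) \<in> parcs G" "(b, c) \<in> parcs G" "(c, d) \<in> parcs G" "(d, a) \<in> parcs G"
    and non: "(a, c) \<notin> parcs G" "(b, d) \<notin> parcs G" "(u, v) \<notin> parcs G" "a \<noteq> c" "b \<noteq> d" "u \<noteq> v"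
    and uv: "u \<in> pverts G" "v \<in> pverts G" "u \<notin> {a, b, c, d}" "v \<notin> {a, b, c, d}"
    and iso: "\<And>w t. w \<in> {u, v} \<Longrightarrow> t \<in> {a, b, c, d} \<Longrightarrow> (w, t) \<notin> parcs G"
  shows False
proof -
  interpret pair_graph G by fact
  have sym: "(s, t) \<in> parcs G \<Longrightarrow> (t, s) \<in> parcs G" for s t
    using pair_sym_arcs unfolding symmetric_def sym_def by simp
  have irr: "(s, s) \<notin> parcs G" for s using pair_no_loops[of "(s, s)"] by auto
  have inV: "a \<in> pverts G" "b \<in> pverts G" "c \<in> pverts G" "d \<in> pverts G"
    using arc_fst_in_verts[OF cyc(1)] arc_fst_in_verts[OF cyc(2)] arc_fst_in_verts[OF cyc(3)]
      arc_fst_in_verts[OF cyc(4)] by simp_all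
  have ne: "a \<noteq> b" "b \<noteq> c" "c \<noteq> d" "d \<noteq> a" using cyc irr by metis+
  define S where "S = {a, b, c, d, u, v}"
  define H where "H = \<lparr>pverts = S, parcs = parcs G \<inter> S \<times> S\<rparr>"
  define f where "f = (\<lambda>i. [a, b, c, d, u, v] ! i)"
  have f: "f 0 = a" "f 1 = b" "f 2 = c" "f 3 = d" "f 4 = u" "f 5 = v" "f (Suc 0) = b" unfolding f_def by simp_all
  have arcs: "parcs G \<inter> S \<times> S =
      {(a, b), (b, c), (c, d), (d, a), (b, a), (c, b), (d, c), (a, d)}" (is "?L = ?R")
  proof
    show "?R \<subseteq> ?L" using cyc sym unfolding S_def by simp
    show "?L \<subseteq> ?R"
    proof
      fix e assume "e \<in> ?L"
      then obtain s t where e: "e = (s, t)" "(s, t) \<in> parcs G" "s \<in> S" "t \<in> S" by auto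
      have n: "\<not> (s \<in> {u, v} \<and> t \<in> {a, b, c, d})" "\<not> (t \<in> {u, v} \<and> s \<in> {a, b, c, d})"
        "\<not> (s \<in> {u, v} \<and> t \<in> {u, v})"
        using iso[of s t] iso[of t s] e(2) sym[OF e(2)] non(3) sym[of v u] irr by blast+
      then have "s \<in> {a, b, c, d}" "t \<in> {a, b, c, d}" using e(3,4) unfolding S_def by blast+
      then show "e \<in> ?R" using e(1,2) irr non(1,2) sym[of c a] sym[of d b] by auto
    qed
  qed
  have wfH: "pair_wf_digraph H" by unfold_locales (auto simp: H_def)
  have "induced_subgraph (with_proj H) (with_proj G)"
    unfolding induced_subgraph_def subgraph_def compatible_def
  proof (intro conjI)
    show "wf_digraph (with_proj G)" by unfold_locales
    show "wf_digraph (with_proj H)" using wfH by (simp only: wf_digraph_wp_iff)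
    show "verts (with_proj H) \<subseteq> verts (with_proj G)" using inV uv by (simp add: H_def S_def)
    show "arcs (with_proj H) \<subseteq> arcs (with_proj G)" by (simp add: H_def)
    show "arcs (with_proj H) = {e \<in> arcs (with_proj G).
        tail (with_proj G) e \<in> verts (with_proj H) \<and> head (with_proj G) e \<in> verts (with_proj H)}"
      by (auto simp: H_def)
  qed simp_all
  moreover have "digraph_iso (with_proj co_bridge) (with_proj H)"
    unfolding digraph_iso_def
  proof (intro exI conjI)
    \<comment> \<open>Arcs are pairs, so \<open>map_prod f f\<close> is the arc map induced by
      \<open>f\<close>, which sends 0 to 3 around the 4-cycle and 4, 5 to \<open>u\<close>,
      \<open>v\<close>.\<close>
    let ?h = "\<lparr>iso_verts = f, iso_arcs = map_prod f f, iso_head = snd, iso_tail = fst\<rparr>"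
    have V: "pverts co_bridge = {0, 1, 2, 3, 4, 5}" by (simp add: co_bridge_def Let_def)
    have A: "parcs co_bridge = {(0, 1), (1, 2), (2, 3), (3, 0), (1, 0), (2, 1), (3, 2), (0, 3)}"
      by (auto simp: co_bridge_def Let_def)
    have inj: "inj_on f (pverts co_bridge)"
      unfolding V using f ne non uv by (auto simp: inj_on_def)
    have "inj_on (map_prod f f) (parcs co_bridge)"
      by (rule inj_on_subset[OF map_prod_inj_on[OF inj inj]]) (auto simp: A V)
    then show "pre_digraph.digraph_isomorphism (with_proj co_bridge) ?h"
      unfolding pre_digraph.digraph_isomorphism_def
      using inj pair_graph_co_bridge[unfolded pair_graph_def pair_digraph_def pair_fin_digraph_def]
      by (simp add: wf_digraph_wp_iff)
    show "with_proj H = app_iso ?h (with_proj co_bridge)"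
      unfolding app_iso_def with_proj_def using arcs f by (simp add: H_def S_def V A)
  qed
  ultimately show False using free unfolding co_bridge_free_def by blast
qed

section \<open>Passage from graphs to the locale and back\<close>

lemma prismatic_nbr:
  assumes "prismatic G" "triangle G {a, b, c}" "v \<in> pverts G" "v \<notin> {a, b, c}"
  shows "(v, a) \<in> parcs G \<or> (v, b) \<in> parcs G \<or> (v, c) \<in> parcs G"
    and "x \<in> {a, b, c} \<Longrightarrow> y \<in> {a, b, c} \<Longrightarrow> (v, x) \<in> parcs G \<Longrightarrow> (v, y) \<in> parcs G \<Longrightarrow> x = y"
  using assms unfolding prismatic_def by (blast, blast)

lemma orientation_oriented_prismatic:
  assumes G: "pair_graph G" "prismatic G" "co_bridge_free G" and Or: "orientation G Or"
  shows "oriented_prismatic (pverts G) (\<lambda>u v. (u, v) \<in> parcs G)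
    (\<lambda>a b c. triangle G {a, b, c} \<and> Or {a, b, c} = cycle_of_list [a, b, c])"
    (is "oriented_prismatic ?V ?E ?D")
proof -
  interpret pair_graph G by (fact G(1))
  have sym: "?E u v \<Longrightarrow> ?E v u" for u v
    using pair_sym_arcs unfolding symmetric_def sym_def by simp
  have irr: "\<not> ?E u u" for u using pair_no_loops[of "(u, u)"] by auto
  have EV: "?E u v \<Longrightarrow> u \<in> ?V" for u v using arc_fst_in_verts by fastforce
  have tr: "triangle G {a, b, c} \<longleftrightarrow> ?E a b \<and> ?E b c \<and> ?E a c" for a b c
    unfolding triangle_def card_three using sym irr EV by blast
  have dist: "a \<noteq> b" "b \<noteq> c" "a \<noteq> c" if "triangle G {a, b, c}" for a b c
    using that unfolding triangle_def card_three by blast+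
  have uniq: "x = y" if "triangle G {a, b, c}" "v \<notin> {a, b, c}" "x \<in> {a, b, c}" "y \<in> {a, b, c}" "?E v x" "?E v y"
    for a b c v x y
    using prismatic_nbr(2)[OF G(2) that(1) EV[OF that(5)] that(2-6)] .
  show ?thesis
  proof
    show "?E v u" if "?E u v" for u v using sym[OF that] .
    show "\<not> ?E u u" for u using irr .
    show "u \<in> ?V" if "?E u v" for u v using EV[OF that] .
    show "?E a b" if "?D a b c" for a b c using that tr by blast
    show "?D b c a" if "?D a b c" for a b c
    proof -
      have "{b, c, a} = {a, b, c}" by blast
      then show ?thesis using that cycle_rotate[of a b c] dist[of a b c] by (simp del: cycle_of_list.simps)
    qed
    show "\<not> ?D a c b" if "?D a b c" for a b c
    proof -
      have "{a, c, b} = {a, b, c}" by blast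
      then show ?thesis using that cycle_asym[of a b c] dist[of a b c] by (simp del: cycle_of_list.simps)
    qed
    show "?D a b c \<or> ?D a c b" if "?E a b" "?E b c" "?E a c" for a b c
    proof -
      have t: "triangle G {a, b, c}" using that tr by blast
      then obtain a' b' c' where eq: "{a, b, c} = {a', b', c'}" and o: "Or {a, b, c} = cycle_of_list [a', b', c']"
        using Or unfolding orientation_def by blast
      note d = dist[OF t] and d' = dist[OF t[unfolded eq]]
      have s: "{a, c, b} = {a, b, c}" by blast
      \<comment> \<open>The given cycle lists the same three vertices in one of six orders, and
        rotation reduces these to two.\<close>
      have "(a', b', c') \<in> {(a, b, c), (b, c, a), (c, a, b), (a, c, b), (c, b, a), (b, a, c)}"
      proof -
        have "a' \<in> {a, b, c}" "b' \<in> {a, b, c}" "c' \<in> {a, b, c}" unfolding eq by simp_all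
        then show ?thesis using d' by (elim insertE emptyE) simp_all
      qed
      then have "cycle_of_list [a', b', c'] = cycle_of_list [a, b, c] \<or>
          cycle_of_list [a', b', c'] = cycle_of_list [a, c, b]"
        using d cycle_rotate[of a b c] cycle_rotate[of b c a] cycle_rotate[of a c b] cycle_rotate[of c b a]
        by (auto simp del: cycle_of_list.simps)
      then show ?thesis using t o unfolding s by (simp del: cycle_of_list.simps)
    qed
    show "?E v a \<or> ?E v b \<or> ?E v c" if "?D a b c" "v \<in> ?V" "v \<notin> {a, b, c}" for a b c v
      using prismatic_nbr(1)[OF G(2) _ that(2,3)] that(1) by blast
    show "v = c" if "?D a b c" "?E v a" "?E v b" for a b c v
      using uniq[of a b c v a b] that dist[of a b c] irr by blast
    show "?E b b'" if D: "?D a b c" "?D a' b' c'" and dj: "{a, b, c} \<inter> {a', b', c'} = {}" and e: "?E a a'"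
      for a b c a' b' c'
    proof (rule ccontr)
      \<comment> \<open>Without the edge \<open>b b'\<close>, the prismatic property forces the
        matching \<open>a a'\<close>, \<open>b c'\<close>, \<open>c b'\<close>. The orientation
        condition then makes the second triangle run \<open>a' c' b'\<close>, against
        \<open>D(2)\<close>.\<close>
      assume nb: "\<not> ?E b b'"
      have t: "triangle G {a, b, c}" "triangle G {a', b', c'}" using D by auto
      note d = dist[OF t(1)] dist[OF t(2)]
      have V: "b \<in> ?V" "c \<in> ?V" using t(1) unfolding triangle_def by auto
      have out: "b \<notin> {a', b', c'}" "c \<notin> {a', b', c'}" "a' \<notin> {a, b, c}" "c' \<notin> {a, b, c}" using dj by auto
      have na: "\<not> ?E b a'" "\<not> ?E c a'"
        using uniq[OF t(1) out(3), of a b] uniq[OF t(1) out(3), of a c] sym[OF e] sym d by blast+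
      then have bc: "?E b c'" using prismatic_nbr(1)[OF G(2) t(2) V(1) out(1)] nb by blast
      then have "\<not> ?E c c'" using uniq[OF t(1) out(4), of b c] sym d by blast
      then have cb: "?E c b'" using prismatic_nbr(1)[OF G(2) t(2) V(2) out(2)] na by blast
      have s: "{a', c', b'} = {a', b', c'}" by blast
      have "Or {a', c', b'} = cycle_of_list [a', c', b']"
        using Or[unfolded orientation_def, THEN conjunct2, rule_format, of a b c a' c' b'] D dj e bc cb
        unfolding s by blast
      then show False using D(2) cycle_asym[OF d(4-6)] unfolding s by (simp del: cycle_of_list.simps)
    qed
    show "\<exists>w\<in>{u, v}. ?E w a \<or> ?E w b \<or> ?E w c \<or> ?E w d"
      if "?E a b" "?E b c" "?E c d" "?E d a" "\<not> ?E a c" "\<not> ?E b d" "a \<noteq> c" "b \<noteq> d" "u \<in> ?V" "v \<in> ?V"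
        "u \<noteq> v" "\<not> ?E u v" "u \<notin> {a, b, c, d}" "v \<notin> {a, b, c, d}" for a b c d u v
    proof (rule ccontr)
      assume "\<not> ?thesis"
      then have "\<not> ?E w t" if "w \<in> {u, v}" "t \<in> {a, b, c, d}" for w t using that by blast
      from co_bridge_freeD[OF G(1,3) that(1-6) that(12) that(7,8,11) that(9,10,13,14) this] show False .
    qed
  qed
qed

text \<open>Stability passes to subsets, so the classes can be cut down to the vertex set and made
  disjoint by removing earlier classes.\<close>

lemma colorable3_three_colorable:
  assumes "colorable3 (pverts G) (\<lambda>u v. (u, v) \<in> parcs G)"
  shows "three_colorable G"
proof -
  obtain A B C where c: "pverts G \<subseteq> A \<union> B \<union> C" "\<forall>u\<in>A. \<forall>v\<in>A. (u, v) \<notin> parcs G"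
    "\<forall>u\<in>B. \<forall>v\<in>B. (u, v) \<notin> parcs G" "\<forall>u\<in>C. \<forall>v\<in>C. (u, v) \<notin> parcs G"
    using assms unfolding colorable3_def by metis
  show ?thesis
    unfolding three_colorable_def
  proof (intro exI conjI)
    show "stable_set G (A \<inter> pverts G)" "stable_set G ((B - A) \<inter> pverts G)"
      "stable_set G ((C - B - A) \<inter> pverts G)"
      using c unfolding stable_set_def by auto
  qed (use c in auto)
qed

theorem theorem5p1:
  fixes G :: "'a pair_pre_digraph"
  assumes "pair_graph G"
    and "prismatic G"
    and "co_bridge_free G"
    and "orientable G"
    and "\<not> three_colorable G"
  shows "\<exists>X. hitting_set G X \<and> card X \<le> 5"
proof -
  obtain Or where Or: "orientation G Or" using assms(4) unfolding orientable_def by blast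
  interpret oriented_prismatic "pverts G" "\<lambda>u v. (u, v) \<in> parcs G"
    "\<lambda>a b c. triangle G {a, b, c} \<and> Or {a, b, c} = cycle_of_list [a, b, c]"
    using orientation_oriented_prismatic[OF assms(1-3) Or] .
  obtain S where S: "finite S" "card S \<le> 5"
    and hit: "\<And>a b c. triangle G {a, b, c} \<Longrightarrow> Or {a, b, c} = cycle_of_list [a, b, c] \<Longrightarrow> S \<inter> {a, b, c} \<noteq> {}"
    using colorable_or_hit colorable3_three_colorable assms(5) unfolding hit5_def by metis
  \<comment> \<open>\<open>hit5\<close> does not confine \<open>S\<close> to the vertices; triangles
    lie in \<open>pverts G\<close>, so the intersection still hits them.\<close>
  have "hitting_set G (S \<inter> pverts G)"
    unfolding hitting_set_def
  proof (intro conjI allI impI)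
    fix T assume T: "triangle G T"
    then obtain a b c where "T = {a, b, c}" "Or T = cycle_of_list [a, b, c]"
      using Or unfolding orientation_def by blast
    then have "S \<inter> T \<noteq> {}" using hit T by blast
    moreover have "T \<subseteq> pverts G" using T unfolding triangle_def by blast
    ultimately show "S \<inter> pverts G \<inter> T \<noteq> {}" by blast
  qed simp
  moreover have "card (S \<inter> pverts G) \<le> 5" using card_mono[OF S(1), of "S \<inter> pverts G"] S(2) by simp
  ultimately show ?thesis by blast
qed

end
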